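(* Let $\Phi$ be a power index that satisfies efficiency (E), the null player property (NP), homogeneous increments sharing (HIS), and discretizability (D) for interval simple games with $n\ge 3$ players. Then $\Phi(v)=\Psi(v)$ for every interval simple game $v$ that is approximable, i.e., $\Phi=\Psi$.
   Context: **Interval simple games.** Let $N=\{1,\dots,n\}$. For $x,y\in\mathbb{R}^n$ write $x\le y$ if $x_i\le y_i$ for all $i$; $\mathbf 0$ and $\mathbf 1$ are the all-zero and all-one vectors. For $S\subseteq N$, $x_S=(x_i)_{i\in S}$ and $x_{-S}=x_{N\setminus S}$; $(y_S,x_{-S})$ is the vector with entries $y_i$ for $i\in S$ and $x_i$ for $i\notin S$. An interval simple game is a function $v:[0,1]^n\to[0,1]$ with $v(\mathbf 0)=0$, $v(\mathbf 1)=1$, and $v(x)\le v(y)$ whenever $x\le y$. A power index is a map $\Phi$ from interval simple games with $n$ players to $\mathbb{R}^n$, $v\mapsto(\Phi_1(v),\dots,\Phi_n(v))$. **The index $\Psi$.** For a permutation $\pi$ of $N$ and $i\in N$ let $\pi_{<i}=\{j:\pi(j)<\pi(i)\}$, and define $\pi_{\le i},\pi_{>i},\pi_{\ge i}$ analogously. Let $\mathcal S_n$ be the set of permutations of $N$. Then $$\Psi_i(v)=\frac1{n!}\sum_{\pi\in\mathcal S_n}\int_{[0,1]^n}\Big([v(x_{\pi_{<i}},\mathbf 1_{\pi_{\ge i}})-v(x_{\pi_{<i}},\mathbf 0_{\pi_{\ge i}})]-[v(x_{\pi_{\le i}},\mathbf 1_{\pi_{>i}})-v(x_{\pi_{\le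 i}},\mathbf 0_{\pi_{>i}})]\Big)\,dx .$$ **(E)** $\sum_{i=1}^n\Phi_i(v)=1$ for all $v$. **(NP)** $\Phi_i(v)=0$ whenever $i$ is a null player of $v$, i.e. $v(x)=v(y)$ for all $x,y\in[0,1]^n$ with $x_j=y_j$ for all $j\ne i$. **Local increments.** For $S\subseteq N$ put $\Delta v(S,x_{-S})=v(\mathbf 1_S,x_{-S})-v(\mathbf 0_S,x_{-S})$. Let $u,v$ be interval simple games for $n$ players and $\varepsilon\ge 0$. - For $\emptyset\subsetneq S\subsetneq N$ and $D=\prod_{i\in N\setminus S}[a_i,b_i]$ with $0\le a_i\le b_i\le 1$, write $u\overset{S,\varepsilon,D}{\hookrightarrow}v$ if (i) for all $x_{-S}\in(0,1)^{N\setminus S}$: $\Delta v(S,x_{-S})=\Delta u(S,x_{-S})$ if $x_{-S}\notin D$, and $\Delta v(S,x_{-S})=\Delta u(S,x_{-S})+\varepsilon$ if $x_{-S}\in\prod_{i\in N\setminus S}(a_i,b_i)$; and (ii) for all nonempty $T\subseteq N$, $T\neq S$, and all $x_{-T}\in(0,1)^{N\setminus T}$: $\Delta v(T,x_{-T})=\Delta u(T,x_{-T})$. - For $S=\emptyset$, with $D=[0,1]^n$: write $u\overset{\emptyset,\varepsilon,D}{\hookrightarrow}v$ if $v(x)=u(x)+\varepsilon$ for all $x\in(0,1)^n$. - For $S=N$, with $D=[c,1]^n$ where $c\in(0,1)$: write $u\overset{N,\varepsilon,D}{\hookrightarrow}v$ if $v(x)=u(x)+\varepsilon$ for all $x\in(c,1)^n$.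 **(HIS)** There are real constants $\lambda_\Phi(S),\gamma_\Phi(S)$ ($\emptyset\subseteq S\subseteq N$), depending only on $S$ (for the given $\Phi$) and not on $u,v,\varepsilon,D$, such that whenever $u\overset{S,\varepsilon,D}{\hookrightarrow}v$ with $\varepsilon>0$, $\Phi_i(v)-\Phi_i(u)=\lambda_\Phi(S)\,\varepsilon\operatorname{vol}(D)$ for $i\in S$ and $\Phi_i(v)-\Phi_i(u)=-\gamma_\Phi(S)\,\varepsilon\operatorname{vol}(D)$ for $i\notin S$, where $\operatorname{vol}(D)$ is the volume of $D$. **Regular step functions.** For $p\ge1$ let $\mathcal D_p=\{(\alpha_0,\dots,\alpha_p): 0=\alpha_0<\alpha_1<\dots<\alpha_p=1\}$, $\mathcal A_p=\{0,\tfrac12,1,\dots,p-\tfrac12,p\}^n$, $\overline{\mathcal A}_p=\{\tfrac12,\tfrac32,\dots,p-\tfrac12\}^n$, and $\omega(\alpha)=\max_{1\le h\le p}(\alpha_h-\alpha_{h-1})$. For $\alpha\in\mathcal D_p$, $e\in\mathcal A_p$ let $(\alpha)_e=I_1\times\dots\times I_n$ with $I_j=\{\alpha_{e_j}\}$ if $e_j$ is an integer and $I_j=(\alpha_{e_j-1/2},\alpha_{e_j+1/2})$ otherwise; $[\alpha]_e$ is its closure and $c_e$ its center. A step function with discretization $\alpha$ is a function $f:[0,1]^n\to[0,1]$ that is constant on $(\alpha)_e$ for every $e\in\mathcal A_p$. It is regular if $f(\mathbf 0)=0$, $f(\mathbf 1)=1$, and $f(x)=\frac1{|E(x)|}\sum_{e\in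 E(x)}f(c_e)$ for all $x\in[0,1]^n\setminus\{\mathbf 0,\mathbf 1\}$, where $E(x)=\{e\in\overline{\mathcal A}_p: x\in[\alpha]_e\}$. **Approximability.** An approximation of an interval simple game $v$ with discretization $\alpha\in\mathcal D_p$ is a regular step function $f$ with discretization $\alpha$ that is an interval simple game and such that for each $e\in\overline{\mathcal A}_p$ there is $x_e\in[\alpha]_e$ with $f(y)=v(x_e)$ for all $y\in(\alpha)_e$. An approximation sequence of $v$ is a sequence $(f^h)_{h\in\mathbb N}$ of approximations of $v$ with discretizations $\alpha^h$ such that $\omega(\alpha^h)\to0$ and $\sup_{x\in[0,1]^n}|v(x)-f^h(x)|\to0$ as $h\to\infty$. $v$ is approximable if it has at least one approximation sequence. **(D)** For every approximable interval simple game $v$ and every approximation sequence $(f^h)$ of $v$, $\lim_{h\to\infty}\Phi(f^h)$ exists and equals $\Phi(v)$.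
   Formalization: As written, (HIS) for S=∅ contradicts (E) and (NP), so no index meets the hypotheses; the formal statement also requires condition (ii), that all other increments Δ(T,·) are unchanged, when S=∅ and S=N, which weakens (HIS) and makes the theorem stronger. *)

theory Defs
  imports "HOL-Analysis.Analysis" "HOL-Combinatorics.Permutations"
begin

(* Players are the elements of a type 'n of sort {finite, linorder}, i.e. N = {1,...,n} with its
   order and n = CARD('n); vectors of R^n are of type real ^ 'n, with the componentwise order,
   so {0..1} is the cube [0,1]^n. *)

definition interval_simple_game :: "(real ^ 'n \<Rightarrow> real) \<Rightarrow> bool" where
  "interval_simple_game v \<longleftrightarrow>
     v \<in> {0..1} \<rightarrow>\<^sub>E {0..1} \<and> v 0 = 0 \<and> v 1 = 1 \<and> mono_on {0..1} v"

(* The vector (c_S, x_{-S}). A vector x_{-S} indexed by the complement of S is represented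
   throughout by a full vector x whose entries in S are irrelevant. *)
definition fill :: "'n set \<Rightarrow> real \<Rightarrow> real ^ 'n \<Rightarrow> real ^ 'n" where
  "fill S c x = (\<chi> i. if i \<in> S then c else x $ i)"

definition Psi :: "(real ^ 'n::{finite,linorder} \<Rightarrow> real) \<Rightarrow> real ^ 'n::{finite,linorder}" where
  "Psi v = (\<chi> i. 1 / fact CARD('n) * (\<Sum>\<pi> | \<pi> permutes UNIV.
     integral {0..1} (\<lambda>x.
       (v (fill {j. \<pi> j \<ge> \<pi> i} 1 x) - v (fill {j. \<pi> j \<ge> \<pi> i} 0 x)) -
       (v (fill {j. \<pi> j > \<pi> i} 1 x) - v (fill {j. \<pi> j > \<pi> i} 0 x)))))"


subsection \<open>Efficiency and null players\<close>

definition efficient :: "((real ^ 'n \<Rightarrow> real) \<Rightarrow> real ^ 'n) \<Rightarrow> bool" where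
  "efficient \<Phi> \<longleftrightarrow> (\<forall>v. interval_simple_game v \<longrightarrow> (\<Sum>i\<in>UNIV. \<Phi> v $ i) = 1)"

definition null_player :: "(real ^ 'n \<Rightarrow> real) \<Rightarrow> 'n \<Rightarrow> bool" where
  "null_player v i \<longleftrightarrow>
     (\<forall>x\<in>{0..1}. \<forall>y\<in>{0..1}. (\<forall>j. j \<noteq> i \<longrightarrow> x $ j = y $ j) \<longrightarrow> v x = v y)"

definition null_player_property :: "((real ^ 'n \<Rightarrow> real) \<Rightarrow> real ^ 'n) \<Rightarrow> bool" where
  "null_player_property \<Phi> \<longleftrightarrow>
     (\<forall>v i. interval_simple_game v \<and> null_player v i \<longrightarrow> \<Phi> v $ i = 0)"


subsection \<open>Homogeneous increments sharing\<close>

definition incr :: "(real ^ 'n \<Rightarrow> real) \<Rightarrow> 'n set \<Rightarrow> real ^ 'n \<Rightarrow> real" where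
  "incr v S x = v (fill S 1 x) - v (fill S 0 x)"

definition same_increments_except ::
    "'n set \<Rightarrow> (real ^ 'n \<Rightarrow> real) \<Rightarrow> (real ^ 'n \<Rightarrow> real) \<Rightarrow> bool" where
  "same_increments_except S u v \<longleftrightarrow>
     (\<forall>T x. T \<noteq> {} \<and> T \<noteq> S \<and> (\<forall>i\<in>-T. x $ i \<in> {0<..<1}) \<longrightarrow> incr v T x = incr u T x)"

(* local_increment S \<epsilon> V u v: u is turned into v by a local increment \<epsilon> of S on some admissible
   box D of volume V.

   The condition same_increments_except is imposed for S = {} and S = UNIV as well. If these two
   cases only asked for v = u + \<epsilon> on the open box (literal_local_increment below), u and v could
   be arbitrary on the boundary of the cube, and increments sharing would contradict efficiency
   and the null player property (literal_HIS_inconsistent). The axiom used here is implied by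
   that literal one (literal_HIS_imp_HIS). *)
inductive local_increment ::
    "'n set \<Rightarrow> real \<Rightarrow> real \<Rightarrow> (real ^ 'n \<Rightarrow> real) \<Rightarrow> (real ^ 'n \<Rightarrow> real) \<Rightarrow> bool" where
  proper: "local_increment S \<epsilon> (\<Prod>i\<in>-S. b $ i - a $ i) u v"
    if "S \<noteq> {}" "S \<noteq> UNIV" "\<epsilon> \<ge> 0"
       "\<forall>i\<in>-S. 0 \<le> a $ i \<and> a $ i \<le> b $ i \<and> b $ i \<le> 1"
       "\<forall>x. (\<forall>i\<in>-S. x $ i \<in> {0<..<1}) \<and> \<not> (\<forall>i\<in>-S. x $ i \<in> {a $ i..b $ i}) \<longrightarrow>
          incr v S x = incr u S x"
       "\<forall>x. (\<forall>i\<in>-S. x $ i \<in> {0<..<1}) \<and> (\<forall>i\<in>-S. x $ i \<in> {a $ i<..<b $ i}) \<longrightarrow>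
          incr v S x = incr u S x + \<epsilon>"
       "same_increments_except S u v"
| empty: "local_increment {} \<epsilon> 1 u v"
    if "\<epsilon> \<ge> 0" "\<forall>x. (\<forall>i. x $ i \<in> {0<..<1}) \<longrightarrow> v x = u x + \<epsilon>"
       "same_increments_except {} u v"
| full: "local_increment (UNIV :: 'n set) \<epsilon> ((1 - c) ^ CARD('n)) u v"
    if "\<epsilon> \<ge> 0" "0 < c" "c < 1" "\<forall>x. (\<forall>i. x $ i \<in> {c<..<1}) \<longrightarrow> v x = u x + \<epsilon>"
       "same_increments_except UNIV u v"

inductive literal_local_increment ::
    "'n set \<Rightarrow> real \<Rightarrow> real \<Rightarrow> (real ^ 'n \<Rightarrow> real) \<Rightarrow> (real ^ 'n \<Rightarrow> real) \<Rightarrow> bool" where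
  proper: "literal_local_increment S \<epsilon> V u v"
    if "S \<noteq> {}" "S \<noteq> UNIV" "local_increment S \<epsilon> V u v"
| empty: "literal_local_increment {} \<epsilon> 1 u v"
    if "\<epsilon> \<ge> 0" "\<forall>x. (\<forall>i. x $ i \<in> {0<..<1}) \<longrightarrow> v x = u x + \<epsilon>"
| full: "literal_local_increment (UNIV :: 'n set) \<epsilon> ((1 - c) ^ CARD('n)) u v"
    if "\<epsilon> \<ge> 0" "0 < c" "c < 1" "\<forall>x. (\<forall>i. x $ i \<in> {c<..<1}) \<longrightarrow> v x = u x + \<epsilon>"

definition shares_increments ::
    "('n set \<Rightarrow> real \<Rightarrow> real \<Rightarrow> (real ^ 'n \<Rightarrow> real) \<Rightarrow> (real ^ 'n \<Rightarrow> real) \<Rightarrow> bool) \<Rightarrow>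
     ((real ^ 'n \<Rightarrow> real) \<Rightarrow> real ^ 'n) \<Rightarrow> bool" where
  "shares_increments R \<Phi> \<longleftrightarrow>
     (\<exists>lam gam :: 'n set \<Rightarrow> real. \<forall>S \<epsilon> V u v.
        interval_simple_game u \<and> interval_simple_game v \<and> \<epsilon> > 0 \<and> R S \<epsilon> V u v \<longrightarrow>
          (\<forall>i\<in>S. \<Phi> v $ i - \<Phi> u $ i = lam S * \<epsilon> * V) \<and>
          (\<forall>i\<in>-S. \<Phi> v $ i - \<Phi> u $ i = - gam S * \<epsilon> * V))"

definition HIS :: "((real ^ 'n \<Rightarrow> real) \<Rightarrow> real ^ 'n) \<Rightarrow> bool" where
  "HIS \<Phi> \<longleftrightarrow> shares_increments local_increment \<Phi>"

lemma literal_HIS_imp_HIS: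
  assumes "shares_increments literal_local_increment \<Phi>"
  shows "HIS \<Phi>"
proof -
  have "literal_local_increment S \<epsilon> V u v" if "local_increment S \<epsilon> V u v"
    for S \<epsilon> V and u v :: "real ^ 'a \<Rightarrow> real"
    using that by cases (use that in \<open>blast intro: literal_local_increment.intros\<close>)+
  then show ?thesis
    using assms unfolding HIS_def shares_increments_def by meson
qed

lemma literal_HIS_inconsistent:
  fixes \<Phi> :: "(real ^ 'n \<Rightarrow> real) \<Rightarrow> real ^ 'n"
  assumes "CARD('n) \<ge> 2" "efficient \<Phi>" "null_player_property \<Phi>"
  shows "\<not> shares_increments literal_local_increment \<Phi>"
proof
  assume "shares_increments literal_local_increment \<Phi>"
  then obtain lam gam :: "'n set \<Rightarrow> real" where sh: "\<And>S \<epsilon> V u v.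
      interval_simple_game u \<Longrightarrow> interval_simple_game v \<Longrightarrow> \<epsilon> > 0 \<Longrightarrow>
      literal_local_increment S \<epsilon> V u v \<Longrightarrow> \<forall>i\<in>-S. \<Phi> v $ i - \<Phi> u $ i = - gam S * \<epsilon> * V"
    unfolding shares_increments_def by metis
  define g :: "'n \<Rightarrow> real \<Rightarrow> real ^ 'n \<Rightarrow> real" where
    "g k t = restrict (\<lambda>x. if x $ k = 0 then 0 else if x $ k = 1 then 1 else t) {0..1}" for k t
  have game: "interval_simple_game (g k t)" if "0 \<le> t" "t \<le> 1" for k t
  proof -
    have "g k t x \<le> g k t y" if "x \<in> {0..1}" "y \<in> {0..1}" "x \<le> y" for x y
    proof -
      have "0 \<le> x $ k" "x $ k \<le> y $ k" "y $ k \<le> 1"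
        using that by (auto simp: less_eq_vec_def)
      then show ?thesis
        using that \<open>0 \<le> t\<close> \<open>t \<le> 1\<close> by (auto simp: g_def)
    qed
    then show ?thesis
      using that by (auto simp: interval_simple_game_def mono_on_def g_def less_eq_vec_def)
  qed
  have null: "null_player (g k t) j" if "j \<noteq> k" for j k t
    using that unfolding null_player_def g_def by auto
  obtain i k :: 'n where ik: "i \<noteq> k"
    using assms(1) by (metis (full_types) UNIV_I card_2_iff' card_le_Suc0_iff_eq finite not_less_eq_eq numeral_2_eq_2)
  let ?u = "g i (1/4)" and ?v = "g k (1/2)"
  have "literal_local_increment {} (1/4) 1 ?u ?v"
    by (rule literal_local_increment.empty)
       (auto simp: g_def less_eq_vec_def less_imp_le order.strict_iff_order)
  from sh[OF game game _ this]
  have diff: "\<Phi> ?v $ j - \<Phi> ?u $ j = - gam {} / 4" for j by simp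
  have one: "(\<Sum>j\<in>UNIV. \<Phi> ?v $ j) = 1" "(\<Sum>j\<in>UNIV. \<Phi> ?u $ j) = 1"
    using assms(2) game by (auto simp: efficient_def)
  then have "(\<Sum>j\<in>UNIV. \<Phi> ?v $ j - \<Phi> ?u $ j) = 0"
    by (simp add: sum_subtractf)
  then have "gam {} = 0" by (simp add: diff)
  then have eq: "\<Phi> ?v $ j = \<Phi> ?u $ j" for j using diff[of j] by simp
  have "\<Phi> ?u $ j = 0" for j
    using assms(3) null ik game eq[of j] unfolding null_player_property_def
    by (cases "j = i") auto
  then show False using one(2) by simp
qed


subsection \<open>Regular step functions\<close>

definition discretization :: "nat \<Rightarrow> (nat \<Rightarrow> real) \<Rightarrow> bool" where
  "discretization p \<alpha> \<longleftrightarrow>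
     p \<ge> 1 \<and> \<alpha> 0 = 0 \<and> \<alpha> p = 1 \<and> (\<forall>h\<in>{1..p}. \<alpha> (h - 1) < \<alpha> h)"

definition mesh :: "nat \<Rightarrow> (nat \<Rightarrow> real) \<Rightarrow> real" where
  "mesh p \<alpha> = Max ((\<lambda>h. \<alpha> h - \<alpha> (h - 1)) ` {1..p})"

(* Cell indices are doubled: the function e stands for the half-integral vector (e j / 2), so
   even entries are the integers and odd entries the proper half-integers. *)
definition cell_indices :: "nat \<Rightarrow> ('n \<Rightarrow> nat) set" where
  "cell_indices p = {e. \<forall>j. e j \<le> 2 * p}"

definition open_cell_indices :: "nat \<Rightarrow> ('n \<Rightarrow> nat) set" where
  "open_cell_indices p = {e. \<forall>j. e j \<le> 2 * p \<and> odd (e j)}"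

definition side :: "(nat \<Rightarrow> real) \<Rightarrow> nat \<Rightarrow> real set" where
  "side \<alpha> m =
     (if even m then {\<alpha> (m div 2)} else {\<alpha> (m div 2)<..<\<alpha> (m div 2 + 1)})"

definition cell :: "(nat \<Rightarrow> real) \<Rightarrow> ('n \<Rightarrow> nat) \<Rightarrow> (real ^ 'n) set" where
  "cell \<alpha> e = {x. \<forall>j. x $ j \<in> side \<alpha> (e j)}"

(* For even e j the two grid points coincide. *)
definition center :: "(nat \<Rightarrow> real) \<Rightarrow> ('n \<Rightarrow> nat) \<Rightarrow> real ^ 'n" where
  "center \<alpha> e = (\<chi> j. (\<alpha> (e j div 2) + \<alpha> ((e j + 1) div 2)) / 2)"

definition step_function :: "nat \<Rightarrow> (nat \<Rightarrow> real) \<Rightarrow> (real ^ 'n \<Rightarrow> real) \<Rightarrow> bool" where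
  "step_function p \<alpha> f \<longleftrightarrow>
     f \<in> {0..1} \<rightarrow>\<^sub>E {0..1} \<and> (\<forall>e\<in>cell_indices p. f constant_on cell \<alpha> e)"

definition adjacent :: "nat \<Rightarrow> (nat \<Rightarrow> real) \<Rightarrow> real ^ 'n \<Rightarrow> ('n \<Rightarrow> nat) set" where
  "adjacent p \<alpha> x = {e \<in> open_cell_indices p. x \<in> closure (cell \<alpha> e)}"

definition regular_step_function ::
    "nat \<Rightarrow> (nat \<Rightarrow> real) \<Rightarrow> (real ^ 'n \<Rightarrow> real) \<Rightarrow> bool" where
  "regular_step_function p \<alpha> f \<longleftrightarrow>
     step_function p \<alpha> f \<and> f 0 = 0 \<and> f 1 = 1 \<and>
     (\<forall>x\<in>{0..1} - {0, 1}. f x =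
        1 / real (card (adjacent p \<alpha> x)) * (\<Sum>e\<in>adjacent p \<alpha> x. f (center \<alpha> e)))"


subsection \<open>Approximability and discretizability\<close>

definition approximation ::
    "(real ^ 'n \<Rightarrow> real) \<Rightarrow> nat \<Rightarrow> (nat \<Rightarrow> real) \<Rightarrow> (real ^ 'n \<Rightarrow> real) \<Rightarrow> bool" where
  "approximation v p \<alpha> f \<longleftrightarrow>
     discretization p \<alpha> \<and> regular_step_function p \<alpha> f \<and> interval_simple_game f \<and>
     (\<forall>e\<in>open_cell_indices p. \<exists>x\<in>closure (cell \<alpha> e). \<forall>y\<in>cell \<alpha> e. f y = v x)"

definition approximation_sequence ::
    "(real ^ 'n \<Rightarrow> real) \<Rightarrow> (nat \<Rightarrow> real ^ 'n \<Rightarrow> real) \<Rightarrow> bool" where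
  "approximation_sequence v f \<longleftrightarrow>
     (\<exists>p \<alpha>. (\<forall>h. approximation v (p h) (\<alpha> h) (f h)) \<and>
        (\<lambda>h. mesh (p h) (\<alpha> h)) \<longlonglongrightarrow> 0 \<and>
        (\<lambda>h. SUP x\<in>{0..1}. \<bar>v x - f h x\<bar>) \<longlonglongrightarrow> 0)"

definition approximable :: "(real ^ 'n \<Rightarrow> real) \<Rightarrow> bool" where
  "approximable v \<longleftrightarrow> (\<exists>f. approximation_sequence v f)"

definition discretizable :: "((real ^ 'n \<Rightarrow> real) \<Rightarrow> real ^ 'n) \<Rightarrow> bool" where
  "discretizable \<Phi> \<longleftrightarrow>
     (\<forall>v f. interval_simple_game v \<and> approximation_sequence v f \<longrightarrow>
        (\<lambda>h. \<Phi> (f h)) \<longlonglongrightarrow> \<Phi> v)"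

end

theory Submission
  imports Defs
begin

text \<open>Increment sharing makes the effect of a local increment on \<open>\<Phi>\<close> linear in the mean increments
  \<open>C v S\<close>, the integral of \<open>\<Delta>v(S, x)\<close> over the cube. A game that is constant on the cells of a grid can be
  transformed into the fixed game "some \<open>x $ j\<close> equals 1" by changing its value on one cell of
  a face at a time, since the increments determine the index and
  do not see interior points or points with both a 0 and a 1 among their coordinates. Hence
  \<open>\<Phi>\<^sub>i f = k\<^sub>i + (\<Sum>S | i \<in> S. \<lambda> S * C f S) - (\<Sum>S | i \<notin> S. \<gamma> S * C f S)\<close> on such games, \<open>S\<close> ranging over
  the proper nonempty coalitions. Efficiency and the null player property, applied to games that only
  depend on which coordinates equal 1, give \<open>|S| * \<lambda> S = (n - |S|) * \<gamma> S\<close>,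
  \<open>\<lambda> (S \<union> {i}) = \<gamma> S\<close>, \<open>k\<^sub>i = \<gamma> (N - {i})\<close> and \<open>(\<Sum>i. k\<^sub>i) = 1\<close>, which force the Shapley
  coefficients; \<open>n \<ge> 3\<close> makes all \<open>\<lambda> {i}\<close> equal. Discretizability passes to the limit by dominated
  convergence.\<close>

section \<open>Mean increments\<close>

lemma cube_iff: "x \<in> {0..1} \<longleftrightarrow> (\<forall>i. 0 \<le> x $ i \<and> x $ i \<le> 1)" for x :: "real ^ 'n"
  by (auto simp: less_eq_vec_def)

lemma fill_nth: "fill S c x $ i = (if i \<in> S then c else x $ i)"
  by (simp add: fill_def)

lemma fill_in_cube:
  fixes x :: "real ^ 'n"
  assumes "0 \<le> c" "c \<le> 1" "\<And>i. i \<notin> S \<Longrightarrow> 0 \<le> x $ i \<and> x $ i \<le> 1"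
  shows "fill S c x \<in> {0..1}"
  using assms by (auto simp: less_eq_vec_def fill_nth)

lemma game_bounds:
  assumes "interval_simple_game v" "x \<in> {0..1}"
  shows "0 \<le> v x" "v x \<le> 1"
  using assms by (force simp: interval_simple_game_def)+

lemma game_mono:
  assumes "interval_simple_game v" "x \<in> {0..1}" "y \<in> {0..1}" "x \<le> y"
  shows "v x \<le> v y"
  using assms by (auto simp: interval_simple_game_def mono_on_def)

definition mean_incr :: "(real ^ 'n \<Rightarrow> real) \<Rightarrow> 'n set \<Rightarrow> real" where
  "mean_incr v S = integral {0..1} (incr v S)"

text \<open>The boundary of the cube is a null set. Over the open cube, hypotheses that only speak
  of coordinates strictly between 0 and 1 suffice.\<close>

lemma mean_incr_box: "mean_incr v S = integral (box 0 1) (incr v S)"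
  unfolding mean_incr_def interval_cbox_cart integral_open_interval ..

lemma mean_incr_cong:
  assumes "\<And>x. x \<in> box 0 1 \<Longrightarrow> incr u S x = incr v S x"
  shows "mean_incr u S = mean_incr v S"
  unfolding mean_incr_box by (rule Henstock_Kurzweil_Integration.integral_cong) (rule assms)

lemma content_unit_cube: "Henstock_Kurzweil_Integration.content (cbox 0 (1 :: real ^ 'n)) = 1"
  by (subst content_cbox_cart) (auto simp: interval_ne_empty_cart)

lemma mean_incr_eq_const:
  fixes v :: "real ^ 'n \<Rightarrow> real"
  assumes "\<And>x. x \<in> box 0 1 \<Longrightarrow> incr v S x = c"
  shows "mean_incr v S = c"
proof -
  have "mean_incr v S = integral (box 0 1) (\<lambda>x :: real ^ 'n. c)"
    unfolding mean_incr_box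
    by (rule Henstock_Kurzweil_Integration.integral_cong) (rule assms)
  then show ?thesis
    by (simp add: integral_open_interval content_unit_cube)
qed

lemma incr_UNIV:
  assumes "interval_simple_game v"
  shows "incr v UNIV x = 1"
proof -
  have "fill UNIV 1 x = 1" "fill UNIV 0 x = 0"
    by (simp_all add: vec_eq_iff fill_nth)
  then show ?thesis
    using assms by (simp add: incr_def interval_simple_game_def)
qed

lemma mean_incr_UNIV: "interval_simple_game v \<Longrightarrow> mean_incr v UNIV = 1"
  by (simp add: mean_incr_eq_const incr_UNIV)

lemma mean_incr_empty: "mean_incr v {} = 0"
  by (rule mean_incr_eq_const) (simp add: incr_def fill_def)

text \<open>Increments evaluate a game on faces, which are null sets, so integrability over the cube
  says nothing about them; it is asked for after each substitution instead.\<close>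

definition face_integrable :: "(real ^ 'n \<Rightarrow> real) \<Rightarrow> bool" where
  "face_integrable v \<longleftrightarrow>
     (\<forall>S. \<forall>c\<in>{0..1}. (\<lambda>x. v (fill S c x)) integrable_on {0..1})"

lemma face_integrable_incr:
  assumes "face_integrable v"
  shows "incr v S integrable_on {0..1}"
proof -
  have "(\<lambda>x. v (fill S 1 x) - v (fill S 0 x)) integrable_on {0..1}"
    using assms unfolding face_integrable_def by (intro integrable_diff) auto
  then show ?thesis
    by (simp add: incr_def[abs_def])
qed

text \<open>Up to null sets the two increments differ by \<epsilon> times the indicator of a box,
  whose volume is the one occurring in \<open>local_increment\<close>.\<close>

lemma mean_incr_add_box:
  fixes u v :: "real ^ 'n \<Rightarrow> real"
  assumes int: "incr u S integrable_on {0..1}"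
    and ab: "\<And>i. i \<notin> S \<Longrightarrow> 0 \<le> a $ i \<and> a $ i \<le> b $ i \<and> b $ i \<le> 1"
    and out: "\<And>x. x \<in> box 0 1 \<Longrightarrow> \<not> (\<forall>i\<in>-S. x $ i \<in> {a $ i..b $ i}) \<Longrightarrow> incr v S x = incr u S x"
    and inn: "\<And>x. x \<in> box 0 1 \<Longrightarrow> \<forall>i\<in>-S. x $ i \<in> {a $ i<..<b $ i} \<Longrightarrow>
      incr v S x = incr u S x + \<epsilon>"
  shows "mean_incr v S = mean_incr u S + \<epsilon> * (\<Prod>i\<in>-S. b $ i - a $ i)"
proof -
  \<comment> \<open>Letting the coordinates in \<open>S\<close> run over all of [0,1] turns the box
    in the free coordinates into a box in the cube with the same volume.\<close>
  define a' b' where "a' = fill S 0 a" and "b' = fill S 1 b"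
  have le: "0 \<le> a' $ i \<and> a' $ i \<le> b' $ i \<and> b' $ i \<le> 1" for i
    using ab[of i] by (auto simp: a'_def b'_def fill_nth)
  have "Henstock_Kurzweil_Integration.content (cbox a' b') = (\<Prod>i\<in>UNIV. b' $ i - a' $ i)"
    using le by (subst content_cbox_cart) (auto simp: interval_ne_empty_cart)
  also have "\<dots> = (\<Prod>i\<in>-S. b $ i - a $ i)"
    by (rule prod.mono_neutral_cong_right) (auto simp: a'_def b'_def fill_nth)
  finally have vol: "Henstock_Kurzweil_Integration.content (cbox a' b') = (\<Prod>i\<in>-S. b $ i - a $ i)" .
  have sub: "cbox a' b' \<subseteq> {0..1}"
    unfolding subset_iff cube_iff mem_box_cart using le by (meson order_trans)
  have "((\<lambda>x. \<epsilon>) has_integral Henstock_Kurzweil_Integration.content (cbox a' b') *\<^sub>R \<epsilon>) (cbox a' b')"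
    by (rule has_integral_const)
  then have "((\<lambda>x. if x \<in> cbox a' b' then \<epsilon> else 0) has_integral Henstock_Kurzweil_Integration.content (cbox a' b') *\<^sub>R \<epsilon>) {0..1}"
    using sub by (simp add: has_integral_restrict)
  from has_integral_add[OF integrable_integral[OF int] this]
  have I: "((\<lambda>x. incr u S x + (if x \<in> cbox a' b' then \<epsilon> else 0)) has_integral
      mean_incr u S + \<epsilon> * (\<Prod>i\<in>-S. b $ i - a $ i)) {0..1}"
    by (simp add: mean_incr_def vol mult.commute)
  have "(incr v S has_integral mean_incr u S + \<epsilon> * (\<Prod>i\<in>-S. b $ i - a $ i)) {0..1}"
  proof (rule has_integral_spike[OF _ _ I])
    show "negligible ((cbox 0 1 - box 0 (1 :: real ^ 'n)) \<union> (cbox a' b' - box a' b'))"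
      by (intro negligible_Un negligible_frontier_interval)
    fix x :: "real ^ 'n"
    assume "x \<in> {0..1} - ((cbox 0 1 - box 0 1) \<union> (cbox a' b' - box a' b'))"
    then have x: "x \<in> box 0 1" and cases: "x \<notin> cbox a' b' \<or> x \<in> box a' b'"
      by (auto simp: interval_cbox_cart)
    from x have x01: "0 < x $ i \<and> x $ i < 1" for i
      by (auto simp: mem_box_cart)
    show "incr v S x = incr u S x + (if x \<in> cbox a' b' then \<epsilon> else 0)"
    proof (cases "x \<in> box a' b'")
      case True
      then have "\<forall>i\<in>-S. x $ i \<in> {a $ i<..<b $ i}" "x \<in> cbox a' b'"
        by (auto simp: mem_box_cart a'_def b'_def fill_nth less_imp_le split: if_splits)
      then show ?thesis using inn[OF x] by simp
    next
      case False
      then have nin: "x \<notin> cbox a' b'" using cases by simp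
      then obtain i where i: "\<not> (a' $ i \<le> x $ i \<and> x $ i \<le> b' $ i)"
        by (auto simp: mem_box_cart)
      then have "i \<notin> S"
        using x01[of i] by (auto simp: a'_def b'_def fill_nth)
      then have "\<not> (\<forall>i\<in>-S. x $ i \<in> {a $ i..b $ i})"
        using i by (auto simp: a'_def b'_def fill_nth)
      then show ?thesis using out[OF x] nin by simp
    qed
  qed
  then show ?thesis
    unfolding mean_incr_def by (rule integral_unique)
qed


section \<open>Graded games\<close>

text \<open>A grading plays the role of a discretization: the cells of the cube are the common level
  sets of the functions \<open>x \<mapsto> loc (x $ j)\<close>, and the endpoints 0 and 1 are levels of their own.\<close>

definition grading :: "(real \<Rightarrow> nat) \<Rightarrow> bool" where
  "grading loc \<longleftrightarrow> mono loc \<and> (\<forall>t\<in>{0<..1}. loc 0 < loc t) \<and> (\<forall>t\<in>{0..<1}. loc t < loc 1)"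

definition graded :: "(real \<Rightarrow> nat) \<Rightarrow> (real ^ 'n \<Rightarrow> real) \<Rightarrow> bool" where
  "graded loc v \<longleftrightarrow>
     (\<forall>x\<in>{0..1}. \<forall>y\<in>{0..1}. (\<forall>j. loc (x $ j) = loc (y $ j)) \<longrightarrow> v x = v y)"

lemma gradedD:
  assumes "graded loc v" "x \<in> {0..1}" "y \<in> {0..1}" "\<And>j. loc (x $ j) = loc (y $ j)"
  shows "v x = v y"
  using assms unfolding graded_def by blast

lemma continuous_fill: "continuous_on UNIV (fill S c :: real ^ 'n \<Rightarrow> real ^ 'n)"
  unfolding fill_def[abs_def]
proof (rule continuous_on_vec_lambda)
  show "continuous_on UNIV (\<lambda>x :: real ^ 'n. if i \<in> S then c else x $ i)" for i
    by (cases "i \<in> S") (auto intro: continuous_intros)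
qed

text \<open>The value of \<open>v\<close> is a function of the vector of levels. That vector takes
  countably many values and depends measurably on the point, as \<open>loc\<close> is monotone, so
  every function of it is measurable, even along a face.\<close>

lemma graded_face_integrable:
  fixes v :: "real ^ 'n \<Rightarrow> real"
  assumes loc: "grading loc" and v: "interval_simple_game v" and gr: "graded loc v"
  shows "face_integrable v"
  unfolding face_integrable_def
proof (intro allI ballI)
  fix S :: "'n set" and c :: real
  assume c: "c \<in> {0..1}"
  define level :: "real ^ 'n \<Rightarrow> 'n \<Rightarrow> nat" where "level x = (\<lambda>j. loc (x $ j))" for x
  \<comment> \<open>\<open>F\<close> reads the value of \<open>v\<close> off a representative of
    each cell; at level vectors not attained in the cube it is unspecified.\<close>
  define F where "F e = v (SOME y. y \<in> {0..1} \<and> level y = e)" for e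
  have F: "v x = F (level x)" if "x \<in> {0..1}" for x
  proof -
    define y where "y = (SOME y. y \<in> {0..1} \<and> level y = level x)"
    have y: "y \<in> {0..1} \<and> level y = level x"
      unfolding y_def by (rule someI[of _ x]) (use that in simp)
    then have "loc (x $ j) = loc (y $ j)" for j
      unfolding level_def by (metis (lifting))
    then have "v x = v y"
      using y by (intro gradedD[OF gr that]) auto
    then show ?thesis
      unfolding F_def y_def .
  qed
  have "mono (\<lambda>t. real (loc t))"
    using loc by (auto simp: grading_def mono_def)
  then have [measurable]: "(\<lambda>t. real (loc t)) \<in> borel_measurable borel"
    by (rule borel_measurable_mono)
  have [measurable]: "fill S c \<in> borel_measurable (borel :: (real ^ 'n) measure)"
    by (intro borel_measurable_continuous_onI continuous_fill)
  have [measurable]: "(\<lambda>x :: real ^ 'n. x $ j) \<in> borel_measurable borel" for j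
    by (intro borel_measurable_continuous_onI continuous_intros)
  have "{x. level (fill S c x) = e} \<in> sets borel" for e
  proof -
    have "{x. level (fill S c x) = e} = {x \<in> space borel. \<forall>j. real (loc (fill S c x $ j)) = real (e j)}"
      by (auto simp: level_def)
    also have "\<dots> \<in> sets borel" by measurable
    finally show ?thesis .
  qed
  then have "(\<lambda>x. level (fill S c x)) \<in> borel \<rightarrow>\<^sub>M count_space UNIV"
    by (subst measurable_count_space_eq_countable) (auto simp: vimage_def)
  then have "(\<lambda>x. F (level (fill S c x))) \<in> borel_measurable borel"
    by (rule measurable_compose) simp
  then have meas: "(\<lambda>x. F (level (fill S c x))) \<in> borel_measurable (lebesgue_on {0..1})"
    by (intro measurable_restrict_space1 measurable_completion) simp
  have fc: "fill S c x \<in> {0..1}" if "x \<in> {0..1}" for x :: "real ^ 'n"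
    using that c by (intro fill_in_cube) (auto simp: less_eq_vec_def)
  have "(\<lambda>x. F (level (fill S c x))) integrable_on {0..1}"
  proof (rule measurable_bounded_by_integrable_imp_integrable[OF meas])
    show "(\<lambda>x :: real ^ 'n. 1 :: real) integrable_on {0..1}"
      by (simp add: interval_cbox_cart integrable_const)
    show "norm (F (level (fill S c x))) \<le> 1" if "x \<in> {0..1}" for x
      using F[OF fc[OF that]] game_bounds[OF v fc[OF that]] by simp
  qed (simp add: interval_cbox_cart)
  then show "(\<lambda>x. v (fill S c x)) integrable_on {0..1}"
    by (rule integrable_eq) (use F fc in simp)
qed

text \<open>Level sets of a monotone function are order convex. Whether they contain their infimum
  and supremum is left open, which suits \<open>local_increment\<close>: it does not constrain the
  boundary of the box.\<close>

lemma level_set_interval: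
  assumes loc: "grading loc" and t0: "0 \<le> t0" "t0 \<le> 1"
  obtains a b where "0 \<le> a" "a \<le> b" "b \<le> 1"
    "\<And>t. 0 \<le> t \<Longrightarrow> t \<le> 1 \<Longrightarrow> loc t = loc t0 \<Longrightarrow> a \<le> t \<and> t \<le> b"
    "\<And>t. a < t \<Longrightarrow> t < b \<Longrightarrow> loc t = loc t0"
proof -
  define I where "I = {t. 0 \<le> t \<and> t \<le> 1 \<and> loc t = loc t0}"
  have bdd: "bdd_below I" "bdd_above I" and ne: "t0 \<in> I"
    using t0 by (auto simp: I_def)
  have bounds: "Inf I \<le> t \<and> t \<le> Sup I" if "t \<in> I" for t
    using that bdd by (auto intro: cInf_lower cSup_upper)
  show thesis
  proof (rule that[of "Inf I" "Sup I"])
    show "0 \<le> Inf I" using ne by (intro cInf_greatest) (auto simp: I_def)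
    show "Sup I \<le> 1" using ne by (intro cSup_least) (auto simp: I_def)
    show "Inf I \<le> Sup I" using bounds[OF ne] by linarith
    show "Inf I \<le> t \<and> t \<le> Sup I" if "0 \<le> t" "t \<le> 1" "loc t = loc t0" for t
      using that bounds by (auto simp: I_def)
    fix t assume t: "Inf I < t" "t < Sup I"
    obtain r where r: "r \<in> I" "r < t" using t ne bdd by (metis cInf_less_iff empty_iff)
    obtain s where s: "s \<in> I" "t < s" using t ne bdd by (metis less_cSup_iff empty_iff)
    have "loc r \<le> loc t" "loc t \<le> loc s"
      using loc r s by (auto simp: grading_def mono_def)
    then show "loc t = loc t0"
      using r s by (simp add: I_def)
  qed
qed

lemma grading_zero:
  assumes "grading loc" "0 \<le> t" "t \<le> 1"
  shows "loc t = loc 0 \<longleftrightarrow> t = 0"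
proof (cases "t = 0")
  case False
  then have "loc 0 < loc t"
    using assms by (simp add: grading_def)
  then show ?thesis using False by simp
qed simp

lemma grading_one:
  assumes "grading loc" "0 \<le> t" "t \<le> 1"
  shows "loc t = loc 1 \<longleftrightarrow> t = 1"
proof (cases "t = 1")
  case False
  then have "loc t < loc 1"
    using assms by (simp add: grading_def)
  then show ?thesis using False by simp
qed simp


section \<open>Increment sharing on graded games\<close>

definition top_game :: "('n set \<Rightarrow> bool) \<Rightarrow> real ^ 'n \<Rightarrow> real" where
  "top_game W = restrict (\<lambda>x. of_bool (W {j. x $ j = 1})) {0..1}"

text \<open>The coarsest grading: on [0,1] its levels are the two endpoints and the open
  interval.\<close>

definition coarse :: "real \<Rightarrow> nat" where
  "coarse t = (if t \<le> 0 then 0 else if t < 1 then 1 else 2)"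

lemma grading_coarse: "grading coarse"
  by (auto simp: grading_def coarse_def mono_def)

lemma graded_top_game:
  fixes W :: "'n::finite set \<Rightarrow> bool"
  shows "graded coarse (top_game W)"
  unfolding graded_def
proof (intro ballI impI)
  fix x y :: "real ^ 'n"
  assume xy: "x \<in> {0..1}" "y \<in> {0..1}" and eq: "\<forall>j. coarse (x $ j) = coarse (y $ j)"
  have "x $ j = 1 \<longleftrightarrow> y $ j = 1" for j
  proof -
    have "x $ j = 1 \<longleftrightarrow> coarse (x $ j) = coarse 1" "y $ j = 1 \<longleftrightarrow> coarse (y $ j) = coarse 1"
      using xy by (auto simp: cube_iff grading_one[OF grading_coarse] simp del: atLeastAtMost_iff)
    then show ?thesis using eq by simp
  qed
  then show "top_game W x = top_game W y"
    using xy by (simp add: top_game_def)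
qed

lemma interval_simple_top_game:
  fixes W :: "'n::finite set \<Rightarrow> bool"
  assumes "\<not> W {}" "W UNIV" "mono W"
  shows "interval_simple_game (top_game W)"
  unfolding interval_simple_game_def
proof (intro conjI)
  show "mono_on {0..1} (top_game W)"
  proof (rule mono_onI)
    fix x y :: "real ^ 'n"
    assume xy: "x \<in> {0..1}" "y \<in> {0..1}" "x \<le> y"
    have "{j. x $ j = 1} \<subseteq> {j. y $ j = 1}"
    proof safe
      fix j assume "x $ j = 1"
      then show "y $ j = 1"
        using xy(2,3) by (simp add: less_eq_vec_def) (metis order_antisym)
    qed
    then show "top_game W x \<le> top_game W y"
      using xy monoD[OF assms(3)] by (auto simp: top_game_def)
  qed
qed (use assms in \<open>auto simp: top_game_def less_eq_vec_def\<close>)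

text \<open>Filling with 1 makes \<open>T\<close> the set of coordinates equal to 1, filling with 0
  leaves none. The increments are thus constant, and they are the worths of the simple game
  \<open>W\<close>.\<close>

lemma incr_top_game:
  assumes "\<not> W {}" "T \<noteq> {}" "\<And>i. i \<notin> T \<Longrightarrow> 0 < x $ i \<and> x $ i < 1"
  shows "incr (top_game W) T x = of_bool (W T)"
proof -
  have "fill T 1 x \<in> {0..1}" "fill T 0 x \<in> {0..1}"
    using assms(3) by (auto intro!: fill_in_cube less_imp_le simp del: atLeastAtMost_iff)
  moreover have "{j. fill T 1 x $ j = 1} = T" "{j. fill T 0 x $ j = 1} = {}"
    using assms(3) by (force simp: fill_nth)+
  ultimately show ?thesis
    using assms(1) by (simp add: incr_def top_game_def)
qed

lemma mean_incr_top_game: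
  assumes "\<not> W {}" "T \<noteq> {}"
  shows "mean_incr (top_game W) T = of_bool (W T)"
  by (rule mean_incr_eq_const, rule incr_top_game) (use assms in \<open>auto simp: mem_box_cart\<close>)

section \<open>The part of the index that mean increments do not explain\<close>

locale increment_sharing =
  fixes \<Phi> :: "(real ^ 'n \<Rightarrow> real) \<Rightarrow> real ^ 'n" and lam gam :: "'n set \<Rightarrow> real"
  assumes two_players: "CARD('n) \<ge> 2"
    and sharing: "interval_simple_game u \<Longrightarrow> interval_simple_game v \<Longrightarrow> \<epsilon> > 0 \<Longrightarrow>
      local_increment S \<epsilon> V u v \<Longrightarrow>
      \<Phi> v $ i - \<Phi> u $ i = (if i \<in> S then lam S else - gam S) * \<epsilon> * V"
begin

definition weight :: "'n \<Rightarrow> 'n set \<Rightarrow> real" where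
  "weight i S = (if i \<in> S then lam S else - gam S)"

text \<open>The candidate for the constant term of an affine formula in the mean increments; the aim
  is that all graded games share it.\<close>

definition residual :: "(real ^ 'n \<Rightarrow> real) \<Rightarrow> 'n \<Rightarrow> real" where
  "residual v i = \<Phi> v $ i - (\<Sum>S | S \<noteq> {} \<and> S \<noteq> UNIV. weight i S * mean_incr v S)"

text \<open>A local increment of \<open>S\<close> raises the mean increment of \<open>S\<close> by
  \<epsilon> times the volume and leaves the other means alone, while the index moves by
  \<open>weight i S\<close> times the same amount. The two changes cancel.\<close>

lemma residual_local_increment:
  assumes games: "interval_simple_game u" "interval_simple_game v"
    and int: "face_integrable u" and eps: "\<epsilon> > 0" and S: "S \<noteq> {}" "S \<noteq> UNIV"
    and ab: "\<And>i. i \<notin> S \<Longrightarrow> 0 \<le> a $ i \<and> a $ i \<le> b $ i \<and> b $ i \<le> 1"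
    and out: "\<And>x. \<forall>i\<in>-S. x $ i \<in> {0<..<1} \<Longrightarrow> \<not> (\<forall>i\<in>-S. x $ i \<in> {a $ i..b $ i}) \<Longrightarrow>
      incr v S x = incr u S x"
    and inn: "\<And>x. \<forall>i\<in>-S. x $ i \<in> {0<..<1} \<Longrightarrow> \<forall>i\<in>-S. x $ i \<in> {a $ i<..<b $ i} \<Longrightarrow>
      incr v S x = incr u S x + \<epsilon>"
    and same: "same_increments_except S u v"
  shows "residual v i = residual u i"
proof -
  let ?V = "\<Prod>i\<in>-S. b $ i - a $ i" and ?P = "{S :: 'n set. S \<noteq> {} \<and> S \<noteq> UNIV}"
  have "local_increment S \<epsilon> ?V u v"
    using S eps ab out inn same by (intro local_increment.proper) auto
  from sharing[OF games eps this, of i] have \<Phi>: "\<Phi> v $ i = \<Phi> u $ i + weight i S * (\<epsilon> * ?V)"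
    by (simp add: weight_def)
  have box: "\<forall>i\<in>-T. x $ i \<in> {0<..<1}" if "x \<in> box 0 1" for x :: "real ^ 'n" and T
    using that by (auto simp: mem_box_cart)
  have "mean_incr v S = mean_incr u S + \<epsilon> * ?V"
    by (rule mean_incr_add_box) (use face_integrable_incr[OF int] ab out inn box in auto)
  moreover have "mean_incr v T = mean_incr u T" if "T \<in> ?P" "T \<noteq> S" for T
    using same box[of _ T] that by (intro mean_incr_cong) (auto simp: same_increments_except_def)
  ultimately have "(\<Sum>T\<in>?P. weight i T * mean_incr v T)
      = (\<Sum>T\<in>?P. weight i T * mean_incr u T + (if T = S then weight i S * (\<epsilon> * ?V) else 0))"
    by (intro sum.cong) (auto simp: algebra_simps)
  also have "\<dots> = (\<Sum>T\<in>?P. weight i T * mean_incr u T) + weight i S * (\<epsilon> * ?V)"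
    using S by (simp add: sum.distrib)
  finally show ?thesis
    using \<Phi> by (simp add: residual_def)
qed

text \<open>A degenerate box has volume 0 and empty interior, so increment sharing applies to it with
  no increment at all: the index only sees the increments.\<close>

lemma residual_same_increments:
  assumes games: "interval_simple_game u" "interval_simple_game v"
    and same: "\<And>T x. T \<noteq> {} \<Longrightarrow> \<forall>i\<in>-T. x $ i \<in> {0<..<1} \<Longrightarrow> incr v T x = incr u T x"
  shows "residual v i = residual u i"
proof -
  obtain j k :: 'n where jk: "j \<noteq> k"
    using two_players by (metis (full_types) UNIV_I card_2_iff' card_le_Suc0_iff_eq finite not_less_eq_eq numeral_2_eq_2)
  then have "k \<in> -{j}" "{j} \<noteq> UNIV"
    by auto
  \<comment> \<open>As \<open>k\<close> lies outside \<open>{j}\<close>, the box has no interior, so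
    the increment 1 is demanded nowhere; the volume has a factor 0 for the same reason.\<close>
  then have "local_increment {j} 1 (\<Prod>i\<in>-{j}. (0 :: real ^ 'n) $ i - 0 $ i) u v"
    using same by (intro local_increment.proper) (fastforce simp: same_increments_except_def)+
  moreover have "(\<Prod>i\<in>-{j}. (0 :: real ^ 'n) $ i - 0 $ i) = 0"
    using jk by (intro prod_zero) auto
  ultimately have "local_increment {j} 1 0 u v"
    by (simp only:)
  then have "\<Phi> v $ i = \<Phi> u $ i"
    using sharing[OF games, of 1 "{j}" 0 i] by simp
  moreover have "mean_incr v T = mean_incr u T" if "T \<noteq> {}" for T
    using that same by (intro mean_incr_cong) (auto simp: mem_box_cart)
  ultimately show ?thesis
    by (simp add: residual_def)
qed

text \<open>Endpoints are levels of their own, so among the points that enter increments only those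
  of \<open>S\<close> on the side \<open>c\<close> meet the cell of \<open>z\<close>. Moving its
  value to \<open>c\<close> is therefore a local increment of \<open>S\<close>, on the box spanned
  by the level sets of the free coordinates of \<open>z\<close>.\<close>

lemma residual_change_cell:
  assumes loc: "grading loc" and gr: "graded loc f"
    and games: "interval_simple_game f" "interval_simple_game g"
    and S: "S \<noteq> {}" "S \<noteq> UNIV" and c: "c = 0 \<or> c = 1"
    and z: "\<And>i. i \<in> S \<Longrightarrow> z $ i = c" "\<And>i. i \<notin> S \<Longrightarrow> 0 < z $ i \<and> z $ i < 1"
    and off: "\<And>y. y \<in> {0..1} \<Longrightarrow> \<exists>j. loc (y $ j) \<noteq> loc (z $ j) \<Longrightarrow> g y = f y"
    and on: "\<And>y. y \<in> {0..1} \<Longrightarrow> \<forall>j. loc (y $ j) = loc (z $ j) \<Longrightarrow> g y = c"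
    and neq: "f z \<noteq> c"
  shows "residual g i = residual f i"
proof -
  \<comment> \<open>Raising the upper value to 1 and lowering the lower value to 0 both enlarge the
    increment of \<open>S\<close>, hence the absolute value.\<close>
  define \<epsilon> where "\<epsilon> = \<bar>c - f z\<bar>"
  have z01: "z \<in> {0..1}"
    unfolding cube_iff using z c by (metis less_imp_le order_refl zero_le_one)
  have f_on: "f y = f z" if "y \<in> {0..1}" "\<forall>j. loc (y $ j) = loc (z $ j)" for y
    using that z01 by (intro gradedD[OF gr]) auto
  \<comment> \<open>A filled point has endpoint values exactly at the coordinates in
    \<open>T\<close>, and levels detect endpoints.\<close>
  have face: "T = S \<and> d = c"
    if T: "T \<noteq> {}" and d: "d = 0 \<or> d = 1" and x: "\<forall>i\<in>-T. x $ i \<in> {0<..<1}"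
      and eq: "\<forall>j. loc (fill T d x $ j) = loc (z $ j)" for T d and x :: "real ^ 'n"
  proof -
    have end_iff: "loc t = loc e \<longleftrightarrow> t = e" if "e = 0 \<or> e = 1" "0 \<le> t" "t \<le> 1" for t e
      using that grading_zero[OF loc] grading_one[OF loc] by auto
    have zT: "z $ j = d" if "j \<in> T" for j
      using eq[rule_format, of j] that end_iff[OF d, of "z $ j"] z01
      by (auto simp: fill_nth cube_iff simp del: atLeastAtMost_iff)
    have "j \<in> S" if "j \<in> T" for j
    proof (rule ccontr)
      assume "j \<notin> S"
      then show False using z(2)[of j] zT[OF that] d by auto
    qed
    moreover have "j \<in> T" if "j \<in> S" for j
    proof (rule ccontr)
      assume j: "j \<notin> T"
      then have "loc (x $ j) = loc c"
        using eq[rule_format, of j] z(1)[OF that] by (simp add: fill_nth)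
      moreover have "0 < x $ j \<and> x $ j < 1"
        using x j by auto
      ultimately show False
        using end_iff[OF c, of "x $ j"] c by auto
    qed
    ultimately show ?thesis
      using T zT z(1) by blast
  qed
  have fill01: "fill T d x \<in> {0..1}"
    if "d = 0 \<or> d = 1" "\<forall>i\<in>-T. x $ i \<in> {0<..<1}" for T d and x :: "real ^ 'n"
    using that by (intro fill_in_cube) (auto intro: less_imp_le)
  have fill_off: "g (fill T d x) = f (fill T d x)"
    if "T \<noteq> {}" "d = 0 \<or> d = 1" "\<forall>i\<in>-T. x $ i \<in> {0<..<1}" "\<not> (T = S \<and> d = c)"
    for T d and x :: "real ^ 'n"
    using that face[OF that(1-3)] by (intro off fill01) auto
  have same: "same_increments_except S f g"
    by (auto simp: same_increments_except_def incr_def fill_off)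
  have incr: "incr g S x = incr f S x + (if \<forall>i\<in>-S. loc (x $ i) = loc (z $ i) then \<epsilon> else 0)"
    if x: "\<forall>i\<in>-S. x $ i \<in> {0<..<1}" for x
  proof -
    have cell: "(\<forall>j. loc (fill S c x $ j) = loc (z $ j)) \<longleftrightarrow> (\<forall>i\<in>-S. loc (x $ i) = loc (z $ i))"
      using z(1) by (auto simp: fill_nth)
    have g_c: "g (fill S c x) = (if \<forall>i\<in>-S. loc (x $ i) = loc (z $ i) then c else f (fill S c x))"
      using cell on[OF fill01[OF c x]] off[OF fill01[OF c x]] by auto
    have f_c: "\<forall>i\<in>-S. loc (x $ i) = loc (z $ i) \<Longrightarrow> f (fill S c x) = f z"
      using cell f_on[OF fill01[OF c x]] by auto
    have other: "g (fill S (1 - c) x) = f (fill S (1 - c) x)"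
      using c by (intro fill_off S x) auto
    have "0 \<le> f z" "f z \<le> 1"
      using game_bounds[OF games(1) z01] by auto
    then show ?thesis
      using g_c f_c other c unfolding incr_def \<epsilon>_def by (auto simp: abs_if)
  qed
  have "\<exists>a b. 0 \<le> a \<and> a \<le> b \<and> b \<le> 1 \<and>
      (\<forall>t. 0 \<le> t \<and> t \<le> 1 \<and> loc t = loc (z $ i) \<longrightarrow> a \<le> t \<and> t \<le> b) \<and>
      (\<forall>t. a < t \<and> t < b \<longrightarrow> loc t = loc (z $ i))" for i
    by (rule level_set_interval[OF loc, of "z $ i"]) (use z01 in \<open>auto simp: less_eq_vec_def\<close>)
  then obtain a b where ab: "\<And>i. 0 \<le> a i \<and> a i \<le> b i \<and> b i \<le> (1 :: real)"
    and ab_out: "\<And>i t. 0 \<le> t \<Longrightarrow> t \<le> 1 \<Longrightarrow> loc t = loc (z $ i) \<Longrightarrow> a i \<le> t \<and> t \<le> b i"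
    and ab_in: "\<And>i t. a i < t \<Longrightarrow> t < b i \<Longrightarrow> loc t = loc (z $ i)"
    by metis
  show ?thesis
  proof (rule residual_local_increment[OF games graded_face_integrable[OF loc games(1) gr] _ S _ _ _ same])
    show "0 < \<epsilon>" using neq by (simp add: \<epsilon>_def)
    show "0 \<le> (\<chi> i. a i) $ i \<and> (\<chi> i. a i) $ i \<le> (\<chi> i. b i) $ i \<and> (\<chi> i. b i) $ i \<le> 1" for i
      using ab by simp
    fix x :: "real ^ 'n"
    assume x: "\<forall>i\<in>-S. x $ i \<in> {0<..<1}"
    show "incr g S x = incr f S x"
      if "\<not> (\<forall>i\<in>-S. x $ i \<in> {(\<chi> i. a i) $ i..(\<chi> i. b i) $ i})"
    proof -
      have "\<not> (\<forall>i\<in>-S. loc (x $ i) = loc (z $ i))"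
      proof
        assume eq: "\<forall>i\<in>-S. loc (x $ i) = loc (z $ i)"
        have "a i \<le> x $ i \<and> x $ i \<le> b i" if "i \<notin> S" for i
          using that x eq by (intro ab_out) (auto intro: less_imp_le)
        then show False
          using that by auto
      qed
      then show ?thesis
        unfolding incr[OF x] by (simp only: if_False add_0_right)
    qed
    show "incr g S x = incr f S x + \<epsilon>"
      if "\<forall>i\<in>-S. x $ i \<in> {(\<chi> i. a i) $ i<..<(\<chi> i. b i) $ i}"
      using that incr[OF x] ab_in by auto
  qed
qed

text \<open>Raise the cells of the upper faces to 1, largest first, and lower those of the lower faces
  to 0, smallest first. Every intermediate function is a game, and in the end every increment of a
  proper coalition is 1.\<close>

lemma residual_graded:
  assumes loc: "grading loc" and f: "interval_simple_game f" "graded loc f"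
  shows "residual f i = residual (top_game (\<lambda>A. A \<noteq> {})) i"
proof -
  define level :: "real ^ 'n \<Rightarrow> 'n \<Rightarrow> nat" where "level x = (\<lambda>j. loc (x $ j))" for x
  \<comment> \<open>For \<open>c\<close> equal to 0 or 1 these are the points
    \<open>fill T c x\<close> with \<open>T\<close> proper and nonempty and the other coordinates
    strictly between 0 and 1: where the increments of such \<open>T\<close> are evaluated.\<close>
  define on_face where "on_face c x \<longleftrightarrow> x \<in> {0..1} \<and> (\<exists>j. x $ j = c) \<and> (\<exists>j. x $ j \<noteq> c) \<and>
      (\<forall>j. x $ j \<noteq> 1 - c)" for c :: real and x :: "real ^ 'n"
  define bad where "bad f c = {x. on_face c x \<and> f x \<noteq> c}" for c and f :: "real ^ 'n \<Rightarrow> real"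
  \<comment> \<open>The number of these cells is the induction measure; it is finite because levels
    are bounded by \<open>loc 1\<close>.\<close>
  define bad_cells where "bad_cells f = level ` (bad f 0 \<union> bad f 1)" for f
  have loc_mono: "loc s \<le> loc t" if "s \<le> t" for s t
    using loc that by (simp add: grading_def mono_def)
  have loc_01: "loc 0 < loc 1"
    using loc by (simp add: grading_def)
  have bounds: "0 \<le> x $ j" "x $ j \<le> 1" if "x \<in> {0..1}" for x :: "real ^ 'n" and j
    using that by (auto simp: less_eq_vec_def)
  have zero: "loc (x $ j) = loc 0 \<longleftrightarrow> x $ j = 0" and one: "loc (x $ j) = loc 1 \<longleftrightarrow> x $ j = 1"
    if "x \<in> {0..1}" for x :: "real ^ 'n" and j
    using bounds[OF that] grading_zero[OF loc] grading_one[OF loc] by auto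
  have finite_bad: "finite (bad_cells f)" for f
  proof (rule finite_subset)
    show "bad_cells f \<subseteq> PiE UNIV (\<lambda>_. {..loc 1})"
      using loc_mono bounds by (auto simp: bad_cells_def bad_def on_face_def level_def simp del: atLeastAtMost_iff)
  qed (auto intro: finite_PiE)
  have face_level: "on_face c x \<longleftrightarrow> on_face c y"
    if "x \<in> {0..1}" "y \<in> {0..1}" "level x = level y" "c = 0 \<or> c = 1" for c x y
  proof -
    have "loc (x $ j) = loc (y $ j)" for j
      using that(3) unfolding level_def by metis
    then have "x $ j = 0 \<longleftrightarrow> y $ j = 0" "x $ j = 1 \<longleftrightarrow> y $ j = 1" for j
      using zero[OF that(1), of j] zero[OF that(2), of j] one[OF that(1), of j] one[OF that(2), of j]
      by simp_all
    then show ?thesis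
      using that unfolding on_face_def by auto
  qed
  from f show ?thesis
  proof (induction "card (bad_cells f)" arbitrary: f rule: less_induct)
    case less
    note f = less.prems
    \<comment> \<open>It suffices to find a game that takes the value \<open>c\<close> on the cell
      of one bad point and agrees with \<open>f\<close> elsewhere: that cell leaves
      \<open>bad_cells\<close> and no new one enters.\<close>
    have step: "residual f i = residual (top_game (\<lambda>A. A \<noteq> {})) i"
      if g: "interval_simple_game g" and z: "z \<in> bad f c" and c: "c = 0 \<or> c = 1"
        and off: "\<And>y. y \<in> {0..1} \<Longrightarrow> level y \<noteq> level z \<Longrightarrow> g y = f y"
        and on: "\<And>y. y \<in> {0..1} \<Longrightarrow> level y = level z \<Longrightarrow> g y = c"
      for g z c
    proof -
      have z': "on_face c z" "f z \<noteq> c" and z01: "z \<in> {0..1}"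
        using z by (auto simp: bad_def on_face_def)
      have "graded loc g"
        unfolding graded_def
      proof (intro ballI impI)
        fix x y :: "real ^ 'n"
        assume xy: "x \<in> {0..1}" "y \<in> {0..1}" and eq: "\<forall>j. loc (x $ j) = loc (y $ j)"
        then have "level x = level y" by (auto simp: level_def)
        moreover have "f x = f y" using gradedD[OF f(2) xy] eq by simp
        ultimately show "g x = g y"
          using on[OF xy(1)] on[OF xy(2)] off[OF xy(1)] off[OF xy(2)] by metis
      qed
      moreover have "card (bad_cells g) < card (bad_cells f)"
      proof (rule psubset_card_mono[OF finite_bad])
        have "level x \<noteq> level z \<and> x \<in> bad f d" if x: "x \<in> bad g d" and d: "d = 0 \<or> d = 1" for x d
        proof -
          have x01: "x \<in> {0..1}" and xd: "on_face d x" "g x \<noteq> d"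
            using x by (auto simp: bad_def on_face_def)
          have "level x \<noteq> level z"
          proof
            assume eq: "level x = level z"
            then have "on_face d z" "g x = c"
              using face_level[OF x01 z01 eq d] xd on[OF x01] by auto
            then have "d = c"
              using z'(1) c d unfolding on_face_def by auto
            then show False using xd \<open>g x = c\<close> by simp
          qed
          then show ?thesis
            using off[OF x01] xd by (auto simp: bad_def)
        qed
        then have "bad_cells g \<subseteq> bad_cells f - {level z}"
          unfolding bad_cells_def by fast
        moreover have "level z \<in> bad_cells f"
          using z c by (auto simp: bad_cells_def)
        ultimately show "bad_cells g \<subset> bad_cells f" by blast
      qed
      ultimately have "residual g i = residual (top_game (\<lambda>A. A \<noteq> {})) i"
        using less.hyps g by blast
      moreover have "residual g i = residual f i"
      proof (rule residual_change_cell[OF loc f(2,1) g, of "{j. z $ j = c}" c z])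
        show "{j. z $ j = c} \<noteq> {}" "{j. z $ j = c} \<noteq> UNIV"
          using z'(1) by (auto simp: on_face_def)
        show "0 < z $ j \<and> z $ j < 1" if "j \<notin> {j. z $ j = c}" for j
        proof -
          have "z $ j \<noteq> 0" "z $ j \<noteq> 1"
            using that c z'(1) by (auto simp: on_face_def)
          then show ?thesis using bounds[OF z01, of j] by linarith
        qed
        show "g y = f y" if "y \<in> {0..1}" "\<exists>j. loc (y $ j) \<noteq> loc (z $ j)" for y
          using that by (intro off) (auto simp: level_def dest: fun_cong)
        show "g y = c" if "y \<in> {0..1}" "\<forall>j. loc (y $ j) = loc (z $ j)" for y
          using that by (intro on) (auto simp: level_def)
      qed (use c z' in auto)
      ultimately show ?thesis by simp
    qed
    \<comment> \<open>Among the bad points for one \<open>c\<close>, one with greatest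
      \<open>total\<close> has no other bad cell above it, and one with least \<open>total\<close>
      none below it.\<close>
    define total where "total x = (\<Sum>j\<in>UNIV. loc (x $ j))" for x :: "real ^ 'n"
    have total_less: "total x < total y"
      if le: "\<forall>j. loc (x $ j) \<le> loc (y $ j)" and neq: "level x \<noteq> level y" for x y
    proof -
      obtain j where "loc (x $ j) \<noteq> loc (y $ j)"
        using neq by (auto simp: level_def)
      then have "loc (x $ j) < loc (y $ j)"
        using le by (simp add: order.strict_iff_order)
      then show ?thesis
        unfolding total_def using le by (intro sum_strict_mono_ex1) auto
    qed
    consider (upper) "bad f 1 \<noteq> {}" | (lower) "bad f 0 \<noteq> {}" | (none) "bad f 1 = {}" "bad f 0 = {}"
      by blast
    then show ?case
    proof cases
      case upper
      have "total y < Suc (CARD('n) * loc 1)" if "y \<in> bad f 1" for y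
      proof -
        have "total y \<le> (\<Sum>j\<in>(UNIV :: 'n set). loc 1)"
          unfolding total_def using that
          by (intro sum_mono loc_mono) (auto simp: bad_def on_face_def less_eq_vec_def)
        then show ?thesis by simp
      qed
      then obtain z where z: "z \<in> bad f 1" and max: "\<And>y. y \<in> bad f 1 \<Longrightarrow> total y \<le> total z"
        using ex_has_greatest_nat[of "\<lambda>y. y \<in> bad f 1" _ total] upper by blast
      have z01: "z \<in> {0..1}" and z1: "\<exists>j. z $ j = 1" and z0: "\<forall>j. z $ j \<noteq> 0"
        using z by (auto simp: bad_def on_face_def)
      \<comment> \<open>Setting everything above \<open>z\<close> to 1 keeps the function monotone,
        and by maximality of \<open>z\<close> only its own cell really changes.\<close>
      define g where "g = restrict (\<lambda>y. if \<forall>j. loc (z $ j) \<le> loc (y $ j) then 1 else f y) {0..1}"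
      show ?thesis
      proof (rule step[OF _ z])
        show "interval_simple_game g"
          unfolding interval_simple_game_def
        proof (intro conjI)
          show "g \<in> {0..1} \<rightarrow>\<^sub>E {0..1}"
            using game_bounds[OF f(1)] by (auto simp: g_def)
          obtain j where "z $ j = 1" using z1 by blast
          then have "\<not> loc (z $ j) \<le> loc ((0 :: real ^ 'n) $ j)"
            using loc_01 by simp
          then show "g 0 = 0"
            using f(1) by (auto simp: g_def interval_simple_game_def less_eq_vec_def)
          show "g 1 = 1"
            using f(1) by (auto simp: g_def interval_simple_game_def less_eq_vec_def)
          show "mono_on {0..1} g"
          proof (rule mono_onI)
            fix x y :: "real ^ 'n"
            assume xy: "x \<in> {0..1}" "y \<in> {0..1}" "x \<le> y"
            then have "\<forall>j. loc (x $ j) \<le> loc (y $ j)"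
              by (auto simp: less_eq_vec_def intro: loc_mono)
            then show "g x \<le> g y"
              using xy game_mono[OF f(1) xy] game_bounds(2)[OF f(1) xy(1)]
              by (auto simp: g_def simp del: atLeastAtMost_iff intro: order_trans)
          qed
        qed
        fix y :: "real ^ 'n"
        assume y: "y \<in> {0..1}"
        show "g y = 1" if "level y = level z"
        proof -
          have "loc (z $ j) \<le> loc (y $ j)" for j
            using that unfolding level_def by (metis order_refl)
          then show ?thesis using y by (simp add: g_def)
        qed
        show "g y = f y" if "level y \<noteq> level z"
        proof (cases "\<forall>j. loc (z $ j) \<le> loc (y $ j)")
          case True
          \<comment> \<open>A point above \<open>z\<close> has no coordinate 0 and some coordinate
            1. So it is \<open>1\<close> itself or on an upper face, where it is not bad; its value
            is 1 already.\<close>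
          have "total z < total y" using True that by (intro total_less) auto
          then have "y \<notin> bad f 1" using max by force
          moreover have "y $ j \<noteq> 0" for j
          proof
            assume "y $ j = 0"
            then have "loc (z $ j) = loc 0"
              using True loc_mono[OF bounds(1)[OF z01, of j]] by (metis order_antisym)
            then show False using zero[OF z01] z0 by auto
          qed
          moreover have "\<exists>j. y $ j = 1"
          proof -
            obtain j where "z $ j = 1" using z1 by blast
            then have "loc (y $ j) = loc 1"
              using True loc_mono[OF bounds(2)[OF y, of j]] by (metis order_antisym)
            then show ?thesis using one[OF y] by auto
          qed
          ultimately have "f y = 1 \<or> (\<forall>j. y $ j = 1)"
            using y by (auto simp: bad_def on_face_def)
          then have "f y = 1"
          proof
            assume "\<forall>j. y $ j = 1"
            then have "y = 1" by (simp add: vec_eq_iff)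
            then show ?thesis using f(1) by (simp add: interval_simple_game_def)
          qed
          then show ?thesis using True y by (simp add: g_def)
        next
          case False
          then show ?thesis
            using y by (simp only: g_def restrict_apply if_True if_False)
        qed
      qed simp
    next
      case lower
      then obtain z where z: "z \<in> bad f 0" and min: "\<And>y. y \<in> bad f 0 \<Longrightarrow> total z \<le> total y"
        using ex_has_least_nat[of "\<lambda>y. y \<in> bad f 0" _ total] by blast
      have z01: "z \<in> {0..1}" and z0: "\<exists>j. z $ j = 0" and z1: "\<forall>j. z $ j \<noteq> 1"
        using z by (auto simp: bad_def on_face_def)
      \<comment> \<open>Dually, everything below \<open>z\<close> is set to 0, and minimality leaves
        the other cells untouched.\<close>
      define g where "g = restrict (\<lambda>y. if \<forall>j. loc (y $ j) \<le> loc (z $ j) then 0 else f y) {0..1}"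
      show ?thesis
      proof (rule step[OF _ z])
        show "interval_simple_game g"
          unfolding interval_simple_game_def
        proof (intro conjI)
          show "g \<in> {0..1} \<rightarrow>\<^sub>E {0..1}"
            using game_bounds[OF f(1)] by (auto simp: g_def)
          obtain j where "z $ j = 0" using z0 by blast
          then have "\<not> loc ((1 :: real ^ 'n) $ j) \<le> loc (z $ j)"
            using loc_01 by simp
          then show "g 1 = 1"
            using f(1) by (auto simp: g_def interval_simple_game_def less_eq_vec_def)
          show "g 0 = 0"
            using f(1) by (auto simp: g_def interval_simple_game_def less_eq_vec_def)
          show "mono_on {0..1} g"
          proof (rule mono_onI)
            fix x y :: "real ^ 'n"
            assume xy: "x \<in> {0..1}" "y \<in> {0..1}" "x \<le> y"
            then have "\<forall>j. loc (x $ j) \<le> loc (y $ j)"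
              by (auto simp: less_eq_vec_def intro: loc_mono)
            then show "g x \<le> g y"
              using xy game_mono[OF f(1) xy] game_bounds(1)[OF f(1) xy(2)]
              by (auto simp: g_def simp del: atLeastAtMost_iff intro: order_trans)
          qed
        qed
        fix y :: "real ^ 'n"
        assume y: "y \<in> {0..1}"
        show "g y = 0" if "level y = level z"
        proof -
          have "loc (y $ j) \<le> loc (z $ j)" for j
            using that unfolding level_def by (metis order_refl)
          then show ?thesis using y by (simp add: g_def)
        qed
        show "g y = f y" if "level y \<noteq> level z"
        proof (cases "\<forall>j. loc (y $ j) \<le> loc (z $ j)")
          case True
          have "total y < total z" using True that by (intro total_less) auto
          then have "y \<notin> bad f 0" using min by force
          moreover have "y $ j \<noteq> 1" for j
          proof
            assume "y $ j = 1"
            then have "loc (z $ j) = loc 1"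
              using True loc_mono[OF bounds(2)[OF z01, of j]] by (metis order_antisym)
            then show False using one[OF z01] z1 by auto
          qed
          moreover have "\<exists>j. y $ j = 0"
          proof -
            obtain j where "z $ j = 0" using z0 by blast
            then have "loc (y $ j) = loc 0"
              using True loc_mono[OF bounds(1)[OF y, of j]] by (metis order_antisym)
            then show ?thesis using zero[OF y] by auto
          qed
          ultimately have "f y = 0 \<or> (\<forall>j. y $ j = 0)"
            using y by (auto simp: bad_def on_face_def)
          then have "f y = 0"
          proof
            assume "\<forall>j. y $ j = 0"
            then have "y = 0" by (simp add: vec_eq_iff)
            then show ?thesis using f(1) by (simp add: interval_simple_game_def)
          qed
          then show ?thesis using True y by (simp add: g_def)
        next
          case False
          then show ?thesis
            using y by (simp only: g_def restrict_apply if_True if_False)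
        qed
      qed simp
    next
      case none
      \<comment> \<open>With no bad point left, every point filled with \<open>c\<close> on a proper
        nonempty coalition has value \<open>c\<close>, so all increments are 1, as in the comparison
        game.\<close>
      have top: "interval_simple_game (top_game (\<lambda>A :: 'n set. A \<noteq> {}))"
        by (intro interval_simple_top_game) (auto simp: mono_def)
      show ?thesis
      proof (rule residual_same_increments[OF top f(1)])
        fix T and x :: "real ^ 'n"
        assume T: "T \<noteq> {}" and x: "\<forall>i\<in>-T. x $ i \<in> {0<..<1}"
        have "incr f T x = 1"
        proof (cases "T = UNIV")
          case True
          then show ?thesis using incr_UNIV[OF f(1)] by simp
        next
          case False
          then obtain k where k: "k \<notin> T" by auto
          have "on_face c (fill T c x)" if "c = 0 \<or> c = 1" for c
          proof -
            have "fill T c x \<in> {0..1}"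
              using that x by (intro fill_in_cube) (auto intro: less_imp_le)
            moreover have "fill T c x $ k \<noteq> c"
              using k x that by (force simp: fill_nth)
            moreover have "fill T c x $ j \<noteq> 1 - c" for j
            proof (cases "j \<in> T")
              case True
              then show ?thesis using that by (auto simp: fill_nth)
            next
              case False
              then have "0 < x $ j" "x $ j < 1" using x by auto
              then show ?thesis using False that by (auto simp: fill_nth)
            qed
            ultimately show ?thesis
              using T k by (auto simp: on_face_def fill_nth)
          qed
          then have "f (fill T c x) = c" if "c = 0 \<or> c = 1" for c
            using none that by (auto simp: bad_def)
          then show ?thesis by (simp add: incr_def)
        qed
        moreover have "incr (top_game (\<lambda>A. A \<noteq> {})) T x = 1"
          using T x by (subst incr_top_game) auto
        ultimately show "incr f T x = incr (top_game (\<lambda>A. A \<noteq> {})) T x" by simp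
      qed
    qed
  qed
qed

end


section \<open>The index of a graded game\<close>

lemma null_player_top_game:
  fixes W :: "'n::finite set \<Rightarrow> bool"
  assumes "\<And>R. W R \<longleftrightarrow> W (R - {i})"
  shows "null_player (top_game W) i"
  unfolding null_player_def
proof (intro ballI impI)
  fix x y :: "real ^ 'n"
  assume xy: "x \<in> {0..1}" "y \<in> {0..1}" and eq: "\<forall>j. j \<noteq> i \<longrightarrow> x $ j = y $ j"
  have "{j. x $ j = 1} - {i} = {j. y $ j = 1} - {i}"
    using eq by auto
  then show "top_game W x = top_game W y"
    using xy assms[of "{j. x $ j = 1}"] assms[of "{j. y $ j = 1}"] by (simp add: top_game_def)
qed

definition proper_coalitions :: "'n set set" where
  "proper_coalitions = {S. S \<noteq> {} \<and> S \<noteq> UNIV}"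

text \<open>\<open>fact CARD('n)\<close> times the coefficient of the worth of \<open>S\<close> in
  the Shapley value of player \<open>i\<close>; mean increments will stand for the worths.\<close>

definition shapley_coeff :: "'n::finite \<Rightarrow> 'n set \<Rightarrow> real" where
  "shapley_coeff i S =
     (if i \<in> S then fact (card S - 1) * fact (CARD('n) - card S)
      else - (fact (card S) * fact (CARD('n) - card S - 1)))"

locale efficient_sharing = increment_sharing \<Phi> lam gam
  for \<Phi> :: "(real ^ 'n::finite \<Rightarrow> real) \<Rightarrow> real ^ 'n" and lam gam :: "'n set \<Rightarrow> real" +
  assumes three_players: "CARD('n) \<ge> 3"
    and efficient: "efficient \<Phi>"
    and null: "null_player_property \<Phi>"
begin

text \<open>The common residual of all graded games.\<close>

definition base :: "'n \<Rightarrow> real" where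
  "base = residual (top_game (\<lambda>A :: 'n set. A \<noteq> {}))"

lemma index_graded:
  assumes "grading loc" "interval_simple_game f" "graded loc f"
  shows "\<Phi> f $ i = base i + (\<Sum>S\<in>proper_coalitions. weight i S * mean_incr f S)"
  using residual_graded[OF assms, of i] by (simp add: base_def residual_def proper_coalitions_def)

text \<open>The mean increments are 0 or 1 here, so the index adds up the weights of the winning
  proper coalitions. Comparing games that differ in one or two coalitions isolates weights.\<close>

lemma index_top_game:
  assumes "\<not> W {}" "W UNIV" "mono W"
  shows "\<Phi> (top_game W) $ i = base i + (\<Sum>S | S \<in> proper_coalitions \<and> W S. weight i S)"
proof -
  have "(\<Sum>S\<in>proper_coalitions. weight i S * mean_incr (top_game W) S)
      = (\<Sum>S\<in>proper_coalitions. if W S then weight i S else 0)"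
    using assms by (intro sum.cong) (auto simp: mean_incr_top_game proper_coalitions_def)
  then show ?thesis
    using index_graded[OF grading_coarse interval_simple_top_game[OF assms] graded_top_game, where i = i]
    by (simp add: sum.inter_filter)
qed

section \<open>Relations from efficiency and the null player property\<close>

lemma sum_base: "(\<Sum>i\<in>UNIV. base i) = 1"
proof -
  \<comment> \<open>Only the full coalition wins, so no weight enters.\<close>
  let ?W = "\<lambda>R :: 'n set. R = UNIV"
  have W: "\<not> ?W {}" "?W UNIV" "mono ?W"
    by (auto simp: mono_def)
  have none: "{S. S \<in> proper_coalitions \<and> ?W S} = {}"
    by (auto simp: proper_coalitions_def)
  have "\<Phi> (top_game ?W) $ i = base i" for i
    unfolding index_top_game[of ?W, OF W] none by simp
  then have "(\<Sum>i\<in>UNIV. base i) = (\<Sum>i\<in>UNIV. \<Phi> (top_game ?W) $ i)"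
    by (intro sum.cong) simp_all
  then show ?thesis
    using efficient interval_simple_top_game[of ?W, OF W] by (simp add: efficient_def)
qed

text \<open>The games won by the strict supersets and by all supersets of \<open>T\<close> differ in
  \<open>T\<close> alone, so their indices differ by the weights of \<open>T\<close>; both indices
  sum to 1.\<close>

lemma sum_weight:
  assumes T: "T \<in> proper_coalitions"
  shows "(\<Sum>i\<in>UNIV. weight i T) = 0"
proof -
  let ?u = "\<lambda>R. T \<subset> R" and ?v = "\<lambda>R. T \<subseteq> R"
  have u: "\<not> ?u {}" "?u UNIV" "mono ?u"
    and v: "\<not> ?v {}" "?v UNIV" "mono ?v"
    using T by (auto simp: proper_coalitions_def mono_def)
  have "{S. S \<in> proper_coalitions \<and> ?v S} = insert T {S. S \<in> proper_coalitions \<and> ?u S}"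
    using T by auto
  then have "weight i T = \<Phi> (top_game ?v) $ i - \<Phi> (top_game ?u) $ i" for i
    using index_top_game[of ?u, OF u, where i = i] index_top_game[of ?v, OF v, where i = i] by simp
  then show ?thesis
    using efficient interval_simple_top_game[of ?u, OF u] interval_simple_top_game[of ?v, OF v]
    by (simp add: efficient_def sum_subtractf)
qed

lemma lam_gam:
  assumes T: "T \<in> proper_coalitions"
  shows "card T * lam T = (CARD('n) - card T) * gam T"
proof -
  have "(\<Sum>i\<in>UNIV. weight i T) = (\<Sum>i\<in>T. weight i T) + (\<Sum>i\<in>-T. weight i T)"
    by (subst sum.union_disjoint[symmetric]) auto
  also have "\<dots> = card T * lam T - (CARD('n) - card T) * gam T"
    by (simp add: weight_def Compl_eq_Diff_UNIV card_Diff_subset)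
  finally show ?thesis
    using sum_weight[OF T] by simp
qed

text \<open>Player \<open>i\<close> is null in two games that differ exactly in \<open>S\<close> and
  \<open>insert i S\<close>, so its two weights cancel. As \<open>insert i S\<close> is not
  everything, it carries a weight and the smaller game is won by \<open>UNIV\<close>.\<close>

lemma lam_insert:
  assumes "S \<noteq> {}" "i \<notin> S" "insert i S \<noteq> UNIV"
  shows "lam (insert i S) = gam S"
proof -
  let ?u = "\<lambda>R. S \<subset> R - {i}" and ?v = "\<lambda>R. S \<subseteq> R - {i}"
  have u: "\<not> ?u {}" "?u UNIV" "mono ?u"
    and v: "\<not> ?v {}" "?v UNIV" "mono ?v"
    using assms by (auto simp: mono_def)
  have "{R. R \<in> proper_coalitions \<and> ?v R} =
      insert S (insert (insert i S) {R. R \<in> proper_coalitions \<and> ?u R})"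
    using assms by (auto simp: proper_coalitions_def)
  moreover have "insert i S \<noteq> S" "\<not> ?u S" "\<not> ?u (insert i S)"
    using assms by auto
  ultimately have "\<Phi> (top_game ?v) $ i - \<Phi> (top_game ?u) $ i = weight i S + weight i (insert i S)"
    using index_top_game[of ?u, OF u, where i = i] index_top_game[of ?v, OF v, where i = i] by simp
  moreover have "null_player (top_game ?u) i" "null_player (top_game ?v) i"
    by (intro null_player_top_game; auto)+
  ultimately show ?thesis
    using null interval_simple_top_game[of ?u, OF u] interval_simple_top_game[of ?v, OF v] assms
    by (simp add: null_player_property_def weight_def)
qed

lemma card_compl_singleton: "card (- {i :: 'n}) = CARD('n) - 1"
  by (simp add: Compl_eq_Diff_UNIV card_Diff_subset)

lemma compl_singleton_proper: "- {i :: 'n} \<in> proper_coalitions"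
proof -
  have "0 < card (- {i})"
    using two_players by (simp add: card_compl_singleton)
  then show ?thesis
    unfolding proper_coalitions_def by (auto simp: card_gt_0_iff)
qed

text \<open>The case of \<open>lam_insert\<close> where \<open>insert i S\<close> is everything:
  \<open>- {i}\<close> is the only winning proper coalition, and \<open>base\<close> replaces the
  missing weight.\<close>

lemma base_eq: "base i = gam (- {i})"
proof -
  let ?v = "\<lambda>R. - {i} \<subseteq> R"
  have v: "\<not> ?v {}" "?v UNIV" "mono ?v"
    using compl_singleton_proper[of i] by (auto simp: proper_coalitions_def mono_def)
  have "{R. R \<in> proper_coalitions \<and> ?v R} = {- {i}}"
    using compl_singleton_proper[of i] by (auto simp: proper_coalitions_def)
  then have "\<Phi> (top_game ?v) $ i = base i - gam (- {i})"
    using index_top_game[of ?v, OF v, where i = i] by (simp add: weight_def)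
  moreover have "null_player (top_game ?v) i"
    by (intro null_player_top_game) auto
  ultimately show ?thesis
    using null interval_simple_top_game[of ?v, OF v] by (simp add: null_player_property_def)
qed

section \<open>Solving the relations\<close>

lemma card_proper:
  fixes S :: "'n set"
  assumes "S \<in> proper_coalitions"
  shows "0 < card S" "card S < CARD('n)"
proof -
  show "0 < card S"
    using assms by (auto simp: proper_coalitions_def card_gt_0_iff)
  show "card S < CARD('n)"
    using assms by (intro psubset_card_mono) (auto simp: proper_coalitions_def)
qed

text \<open>By \<open>lam_gam\<close>, passing from \<open>lam\<close> to \<open>gam\<close>
  multiplies by |S| and divides by n - |S|, which shifts both factorials by one. The scale
  \<open>l\<close> is still free.\<close>

lemma gam_eq:
  assumes S: "S \<in> proper_coalitions" and lam: "lam S = l * (fact (card S - 1) * fact (CARD('n) - card S))"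
  shows "gam S = l * (fact (card S) * fact (CARD('n) - card S - 1))"
proof -
  obtain s m where s: "card S = Suc s" and m: "CARD('n) - card S = Suc m"
    using card_proper[OF S] by (metis Suc_diff_Suc Suc_pred)
  have "real (Suc m) = real (CARD('n)) - real (card S)"
    using m card_proper[OF S] by linarith
  then have "real (Suc m) * gam S = real (Suc s) * lam S"
    using lam_gam[OF S] s by simp
  also have "\<dots> = real (Suc m) * (l * (fact (card S) * fact (CARD('n) - card S - 1)))"
    unfolding lam m by (simp add: s algebra_simps)
  finally show ?thesis
    by (simp del: of_nat_Suc)
qed

text \<open>\<open>lam_insert\<close> and \<open>gam_eq\<close> carry the formula from
  \<open>S\<close> to \<open>insert i S\<close>, so it remains to see that all singletons have the
  same \<open>lam\<close>; \<open>l\<close> is read off a reference player \<open>k\<close>.\<close>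

lemma lam_eq:
  obtains l where "\<And>S. S \<in> proper_coalitions \<Longrightarrow>
    lam S = l * (fact (card S - 1) * fact (CARD('n) - card S))"
proof
  define k where "k = (SOME i :: 'n. True)"
  define l where "l = lam {k} / fact (CARD('n) - 1)"
  have single: "lam {i} = l * fact (CARD('n) - 1)" for i
  proof (cases "i = k")
    case False
    \<comment> \<open>A third player makes \<open>{i, k}\<close> proper, and its \<open>lam\<close>
      equals both \<open>gam {i}\<close> and \<open>gam {k}\<close>.\<close>
    have "card {i, k} < CARD('n)"
      using three_players False by simp
    then have pair: "{i, k} \<noteq> UNIV"
      by (metis less_irrefl)
    then have "gam {i} = gam {k}"
      using lam_insert[of "{i}" k] lam_insert[of "{k}" i] False by (simp add: insert_commute)
    moreover have "{i} \<in> proper_coalitions" "{k} \<in> proper_coalitions"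
      using pair by (auto simp: proper_coalitions_def)
    ultimately have "lam {i} = lam {k}"
      using lam_gam[of "{i}"] lam_gam[of "{k}"] by simp
    then show ?thesis by (simp add: l_def)
  qed (simp add: l_def)
  show "lam S = l * (fact (card S - 1) * fact (CARD('n) - card S))" if "S \<in> proper_coalitions" for S
  proof -
    have "finite S" "S \<noteq> {}" "S \<noteq> UNIV"
      using that by (auto simp: proper_coalitions_def)
    then show ?thesis
    proof (induction rule: finite_ne_induct)
      case (singleton i)
      then show ?case by (simp add: single)
    next
      case (insert i S)
      then have S: "S \<in> proper_coalitions"
        by (auto simp: proper_coalitions_def)
      have "lam (insert i S) = gam S"
        using insert by (intro lam_insert)
      also have "\<dots> = l * (fact (card S) * fact (CARD('n) - card S - 1))"
        using insert S by (intro gam_eq) (auto simp: proper_coalitions_def)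
      finally show ?case
        using insert by simp
    qed
  qed
qed

text \<open>Only the scale is still unknown, and \<open>sum_base\<close> fixes it as
  \<open>1 / fact CARD('n)\<close>.\<close>

lemma index_graded_shapley:
  assumes "grading loc" "interval_simple_game f" "graded loc f"
  shows "\<Phi> f $ i = 1 / fact CARD('n) * (\<Sum>S\<in>UNIV. shapley_coeff i S * mean_incr f S)"
proof -
  obtain l where lam: "\<And>S. S \<in> proper_coalitions \<Longrightarrow>
      lam S = l * (fact (card S - 1) * fact (CARD('n) - card S))"
    using lam_eq by blast
  note gam = gam_eq[OF _ lam]
  have base: "base j = l * fact (CARD('n) - 1)" for j
    using gam[OF compl_singleton_proper compl_singleton_proper, of j]
    by (simp add: base_eq card_compl_singleton)
  have "real CARD('n) * (l * fact (CARD('n) - 1)) = 1"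
    using sum_base by (simp add: base)
  then have "l * fact CARD('n) = 1"
    using two_players by (subst fact_reduce) (auto simp: algebra_simps)
  then have l: "l = 1 / fact CARD('n)"
    by (simp add: field_simps)
  have weight: "weight i S = l * shapley_coeff i S" if "S \<in> proper_coalitions" for S
    using lam[OF that] gam[OF that that] by (simp add: weight_def shapley_coeff_def)
  have "UNIV = insert {} (insert UNIV proper_coalitions)"
    by (auto simp: proper_coalitions_def)
  then have "(\<Sum>S\<in>UNIV. shapley_coeff i S * mean_incr f S)
      = (\<Sum>S\<in>insert {} (insert UNIV proper_coalitions). shapley_coeff i S * mean_incr f S)"
    by (rule arg_cong)
  \<comment> \<open>The full coalition has mean increment 1, so its summand accounts for
    \<open>base\<close>; the empty one contributes 0.\<close>
  also have "\<dots> = shapley_coeff i UNIV + (\<Sum>S\<in>proper_coalitions. shapley_coeff i S * mean_incr f S)"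
    using assms(2) by (simp add: proper_coalitions_def mean_incr_empty mean_incr_UNIV)
  finally have "1 / fact CARD('n) * (\<Sum>S\<in>UNIV. shapley_coeff i S * mean_incr f S)
      = l * fact (CARD('n) - 1) + (\<Sum>S\<in>proper_coalitions. l * (shapley_coeff i S * mean_incr f S))"
    by (simp add: l shapley_coeff_def distrib_left sum_distrib_left)
  also have "\<dots> = \<Phi> f $ i"
    unfolding index_graded[OF assms] base
    by (intro arg_cong2[where f = "(+)"] refl sum.cong) (simp add: weight)
  finally show ?thesis ..
qed

end


section \<open>Counting permutations\<close>

definition upper_perms :: "'n \<Rightarrow> 'n set \<Rightarrow> ('n::linorder \<Rightarrow> 'n) set" where
  "upper_perms i S = {\<pi>. \<pi> permutes UNIV \<and> {j. \<pi> j \<ge> \<pi> i} = S}"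

lemma finite_upper_perms: "finite (upper_perms (i :: 'n::{finite,linorder}) S)"
  by (simp add: upper_perms_def finite_permutations)

text \<open>By injectivity only \<open>i\<close> occupies its own position, so one count serves both
  signs of \<open>shapley_coeff\<close>.\<close>

lemma upper_perms_strict:
  assumes "i \<notin> S"
  shows "{\<pi>. \<pi> permutes UNIV \<and> {j. \<pi> j > \<pi> i} = S} = upper_perms i (insert i S)"
proof -
  have "{j. \<pi> j > \<pi> i} = S \<longleftrightarrow> {j. \<pi> j \<ge> \<pi> i} = insert i S" if "\<pi> permutes UNIV" for \<pi>
  proof -
    have "{j. \<pi> j \<ge> \<pi> i} = insert i {j. \<pi> j > \<pi> i}"
      using injD[OF permutes_inj[OF that]] by (auto simp: le_less)
    then show ?thesis
      using assms by auto
  qed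
  then show ?thesis
    by (auto simp: upper_perms_def)
qed

text \<open>Exchanging the positions of \<open>i\<close> and \<open>k\<close> is injective. Used in
  both directions, this shows that the count is the same for all members of
  \<open>S\<close>.\<close>

lemma card_upper_perms_le:
  fixes i k :: "'n::{finite,linorder}"
  assumes "i \<in> S" "k \<in> S"
  shows "card (upper_perms i S) \<le> card (upper_perms k S)"
proof (rule card_inj_on_le[OF _ _ finite_upper_perms])
  let ?t = "Transposition.transpose i k"
  show "inj_on (\<lambda>\<pi>. \<pi> \<circ> ?t) (upper_perms i S)"
    by (rule inj_onI) (metis comp_assoc comp_id transpose_comp_involutory)
  show "(\<lambda>\<pi>. \<pi> \<circ> ?t) ` upper_perms i S \<subseteq> upper_perms k S"
  proof safe
    fix \<pi> assume \<pi>: "\<pi> \<in> upper_perms i S"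
    have "(\<pi> \<circ> ?t) permutes UNIV"
      using \<pi> by (auto simp: upper_perms_def intro: permutes_compose permutes_swap_id)
    moreover have "\<pi> (?t j) \<ge> \<pi> i \<longleftrightarrow> j \<in> S" for j
    proof -
      have "\<pi> (?t j) \<ge> \<pi> i \<longleftrightarrow> ?t j \<in> S"
        using \<pi> by (auto simp: upper_perms_def)
      also have "\<dots> \<longleftrightarrow> j \<in> S"
        using assms by (auto simp: Transposition.transpose_def)
      finally show ?thesis .
    qed
    ultimately show "\<pi> \<circ> ?t \<in> upper_perms k S"
      by (auto simp: upper_perms_def)
  qed
qed

lemma card_UN_upper_perms:
  fixes S :: "'n::{finite,linorder} \<Rightarrow> 'n set"
  assumes "\<And>i k \<pi>. i \<in> A \<Longrightarrow> k \<in> A \<Longrightarrow> \<pi> \<in> upper_perms i (S i) \<Longrightarrow> \<pi> \<in> upper_perms k (S k) \<Longrightarrow> i = k"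
  shows "card (\<Union>i\<in>A. upper_perms i (S i)) = (\<Sum>i\<in>A. card (upper_perms i (S i)))"
  using assms by (intro card_UN_disjoint) (auto simp: finite_upper_perms)

text \<open>Double counting of the permutations in which \<open>S\<close> comes last: sorted by the
  first member of \<open>S\<close> they form |S| equal classes; sorted by the last player
  \<open>k\<close> before \<open>S\<close> they form classes for \<open>insert k S\<close>, known by
  induction on the complement.\<close>

lemma card_upper_perms:
  fixes i :: "'n::{finite,linorder}"
  assumes "i \<in> S"
  shows "card (upper_perms i S) = fact (card S - 1) * fact (CARD('n) - card S)"
  using assms
proof (induction "card (- S)" arbitrary: S i)
  case (0 S i)
  then have S: "S = UNIV" by auto
  \<comment> \<open>Every permutation has a first player, so the classes exhaust all n!
    permutations.\<close>
  have "(\<Union>k\<in>S. upper_perms k S) = {\<pi>. \<pi> permutes (UNIV :: 'n set)}"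
  proof safe
    fix \<pi> :: "'n \<Rightarrow> 'n" assume \<pi>: "\<pi> permutes UNIV"
    obtain k where "\<pi> k = Min (range \<pi>)"
      using Min_in[of "range \<pi>"] by fastforce
    then have "\<forall>j. \<pi> k \<le> \<pi> j"
      by simp
    then show "\<pi> \<in> (\<Union>k\<in>S. upper_perms k S)"
      using \<pi> S by (auto simp: upper_perms_def)
  qed (auto simp: upper_perms_def)
  moreover have "card (\<Union>k\<in>S. upper_perms k S) = (\<Sum>k\<in>S. card (upper_perms k S))"
  proof (rule card_UN_upper_perms)
    fix k l \<pi> assume "k \<in> S" "l \<in> S" "\<pi> \<in> upper_perms k S" "\<pi> \<in> upper_perms l S"
    then have "\<pi> k \<ge> \<pi> l" "\<pi> l \<ge> \<pi> k" "inj \<pi>"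
      by (auto simp: upper_perms_def permutes_inj)
    then show "k = l" by (auto dest: injD)
  qed
  moreover have "(\<Sum>k\<in>S. card (upper_perms k S)) = (\<Sum>k\<in>S. card (upper_perms i S))"
    using card_upper_perms_le 0 by (intro sum.cong order_antisym) auto
  ultimately have "CARD('n) * card (upper_perms i S) = fact CARD('n)"
    using S by (simp add: card_permutations)
  also have "\<dots> = CARD('n) * fact (CARD('n) - 1)"
    by (simp add: fact_reduce)
  finally show ?case
    using S by simp
next
  case (Suc m S i)
  have card: "card S + Suc m = CARD('n)"
    using Suc(2) card_Un_disjoint[of S "-S"] by (simp add: Compl_partition)
  have "(\<Union>k\<in>S. upper_perms k S) = (\<Union>k\<in>-S. upper_perms k (insert k S))"
  proof safe
    fix \<pi> k assume k: "k \<in> S" and \<pi>: "\<pi> \<in> upper_perms k S"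
    have "- S \<noteq> {}" using Suc(2) by auto
    then obtain l where "l \<in> - S" "\<pi> l = Max (\<pi> ` (- S))"
      using Max_in[of "\<pi> ` (- S)"] by fastforce
    then have l: "l \<in> - S" "\<And>j. j \<in> - S \<Longrightarrow> \<pi> j \<le> \<pi> l"
      by simp_all
    have perm: "\<pi> permutes UNIV" and up: "\<And>j. \<pi> j \<ge> \<pi> k \<longleftrightarrow> j \<in> S"
      using \<pi> by (auto simp: upper_perms_def)
    have "\<pi> j > \<pi> l \<longleftrightarrow> j \<in> S" for j
      using up[of j] up[of l] l(1) l(2)[of j] by (cases "j \<in> S") auto
    then have "{j. \<pi> j > \<pi> l} = S" by auto
    then have "\<pi> \<in> upper_perms l (insert l S)"
      using perm l(1) by (subst upper_perms_strict[symmetric]) auto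
    then show "\<pi> \<in> (\<Union>k\<in>-S. upper_perms k (insert k S))"
      using l(1) by blast
  next
    fix \<pi> l assume l: "l \<notin> S" and "\<pi> \<in> upper_perms l (insert l S)"
    then have perm: "\<pi> permutes UNIV" and up: "\<And>j. \<pi> j > \<pi> l \<longleftrightarrow> j \<in> S"
      unfolding upper_perms_strict[OF l, symmetric] by auto
    obtain k where "k \<in> S" "\<pi> k = Min (\<pi> ` S)"
      using Min_in[of "\<pi> ` S"] Suc(3) by fastforce
    then have k: "k \<in> S" "\<And>j. j \<in> S \<Longrightarrow> \<pi> k \<le> \<pi> j"
      by simp_all
    have "\<pi> j \<ge> \<pi> k \<longleftrightarrow> j \<in> S" for j
      using up[of j] up[of k] k(1) k(2)[of j] by (cases "j \<in> S") auto
    then show "\<pi> \<in> (\<Union>k\<in>S. upper_perms k S)"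
      using perm k(1) by (auto simp: upper_perms_def)
  qed
  moreover have "card (\<Union>k\<in>S. upper_perms k S) = (\<Sum>k\<in>S. card (upper_perms k S))"
  proof (rule card_UN_upper_perms)
    fix k l \<pi> assume "k \<in> S" "l \<in> S" "\<pi> \<in> upper_perms k S" "\<pi> \<in> upper_perms l S"
    then have "\<pi> k \<ge> \<pi> l" "\<pi> l \<ge> \<pi> k" "inj \<pi>"
      by (auto simp: upper_perms_def permutes_inj)
    then show "k = l" by (auto dest: injD)
  qed
  moreover have "card (\<Union>k\<in>-S. upper_perms k (insert k S)) = (\<Sum>k\<in>-S. card (upper_perms k (insert k S)))"
  proof (rule card_UN_upper_perms)
    fix k l \<pi>
    assume "k \<in> - S" "l \<in> - S" "\<pi> \<in> upper_perms k (insert k S)" "\<pi> \<in> upper_perms l (insert l S)"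
    then have "insert k S = {j. \<pi> k \<le> \<pi> j}" "insert l S = {j. \<pi> l \<le> \<pi> j}" "k \<notin> S" "l \<notin> S"
      by (auto simp: upper_perms_def)
    then show "k = l"
      by (metis insert_iff linear mem_Collect_eq)
  qed
  moreover have "(\<Sum>k\<in>S. card (upper_perms k S)) = (\<Sum>k\<in>S. card (upper_perms i S))"
    using card_upper_perms_le Suc(3) by (intro sum.cong order_antisym) auto
  moreover have "card (upper_perms k (insert k S)) = fact (card S) * fact m" if "k \<in> - S" for k
  proof -
    have "m = card (- insert k S)"
      using Suc(2) that by (simp add: Compl_insert)
    then show ?thesis
      using Suc(1)[of "insert k S" k] that card by (simp flip: card)
  qed
  ultimately have "card S * card (upper_perms i S) = Suc m * (fact (card S) * fact m)"
    using Suc(2) by simp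
  also have "\<dots> = card S * (fact (card S - 1) * fact (Suc m))"
    using Suc(3) by (subst fact_reduce[of "card S"]) (auto simp: card_gt_0_iff algebra_simps)
  finally show ?case
    using Suc(3) by (auto simp flip: card)
qed


section \<open>Discretization\<close>

lemma Psi_shapley:
  fixes v :: "real ^ 'n::{finite,linorder} \<Rightarrow> real"
  assumes "face_integrable v"
  shows "Psi v $ i = 1 / fact CARD('n) * (\<Sum>S\<in>UNIV. shapley_coeff i S * mean_incr v S)"
proof -
  let ?P = "{\<pi>. \<pi> permutes (UNIV :: 'n set)}"
  have fin: "finite ?P"
    by (simp add: finite_permutations)
  \<comment> \<open>Sorting permutations by the coalition they produce turns the sum over
    permutations into one over coalitions.\<close>
  have group: "(\<Sum>\<pi>\<in>?P. mean_incr v (U \<pi>)) = (\<Sum>S\<in>UNIV. card {\<pi>. \<pi> permutes UNIV \<and> U \<pi> = S} * mean_incr v S)"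
    for U :: "('n \<Rightarrow> 'n) \<Rightarrow> 'n set"
  proof -
    have "(\<Sum>\<pi>\<in>?P. mean_incr v (U \<pi>)) = (\<Sum>S\<in>UNIV. \<Sum>\<pi>\<in>{\<pi> \<in> ?P. U \<pi> = S}. mean_incr v (U \<pi>))"
      by (rule sum.group[symmetric]) (auto simp: fin)
    also have "\<dots> = (\<Sum>S\<in>UNIV. card {\<pi>. \<pi> permutes UNIV \<and> U \<pi> = S} * mean_incr v S)"
      by (intro sum.cong) simp_all
    finally show ?thesis .
  qed
  have "integral {0..1} (\<lambda>x. (v (fill {j. \<pi> j \<ge> \<pi> i} 1 x) - v (fill {j. \<pi> j \<ge> \<pi> i} 0 x)) -
       (v (fill {j. \<pi> j > \<pi> i} 1 x) - v (fill {j. \<pi> j > \<pi> i} 0 x)))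
    = mean_incr v {j. \<pi> j \<ge> \<pi> i} - mean_incr v {j. \<pi> j > \<pi> i}" for \<pi> :: "'n \<Rightarrow> 'n"
    unfolding mean_incr_def incr_def[symmetric]
    by (intro Henstock_Kurzweil_Integration.integral_diff face_integrable_incr assms)
  then have "Psi v $ i = 1 / fact CARD('n) *
      ((\<Sum>\<pi>\<in>?P. mean_incr v {j. \<pi> j \<ge> \<pi> i}) - (\<Sum>\<pi>\<in>?P. mean_incr v {j. \<pi> j > \<pi> i}))"
    by (simp only: Psi_def vec_lambda_beta sum_subtractf)
  also have "(\<Sum>\<pi>\<in>?P. mean_incr v {j. \<pi> j \<ge> \<pi> i}) - (\<Sum>\<pi>\<in>?P. mean_incr v {j. \<pi> j > \<pi> i})
      = (\<Sum>S\<in>UNIV. shapley_coeff i S * mean_incr v S)"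
    unfolding group sum_subtractf[symmetric]
  proof (intro sum.cong refl)
    fix S :: "'n set"
    show "card {\<pi>. \<pi> permutes UNIV \<and> {j. \<pi> j \<ge> \<pi> i} = S} * mean_incr v S
        - card {\<pi>. \<pi> permutes UNIV \<and> {j. \<pi> j > \<pi> i} = S} * mean_incr v S
      = shapley_coeff i S * mean_incr v S"
    \<comment> \<open>A player is among its weak but never among its strict successors, so one of
      the two classes is empty.\<close>
    proof (cases "i \<in> S")
      case True
      then have "{\<pi>. \<pi> permutes UNIV \<and> {j. \<pi> j > \<pi> i} = S} = {}"
        by auto
      moreover have "card {\<pi>. \<pi> permutes UNIV \<and> {j. \<pi> j \<ge> \<pi> i} = S}
          = fact (card S - 1) * fact (CARD('n) - card S)"
        using card_upper_perms[OF True] by (simp add: upper_perms_def)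
      ultimately show ?thesis
        using True by (simp only: shapley_coeff_def if_True) simp
    next
      case False
      then have "{\<pi>. \<pi> permutes UNIV \<and> {j. \<pi> j \<ge> \<pi> i} = S} = {}"
        by auto
      moreover have "card {\<pi>. \<pi> permutes UNIV \<and> {j. \<pi> j > \<pi> i} = S}
          = fact (card S) * fact (CARD('n) - card S - 1)"
        using card_upper_perms[of i "insert i S"] False by (simp add: upper_perms_strict)
      ultimately show ?thesis
        using False by (simp only: shapley_coeff_def if_False) simp
    qed
  qed
  finally show ?thesis .
qed

section \<open>Step functions as graded games\<close>

lemma discretization_less:
  assumes "discretization p \<alpha>" "h < k" "k \<le> p"
  shows "\<alpha> h < \<alpha> k"
  using assms(2,3)
proof (induction k)
  case (Suc k)
  have "\<alpha> k < \<alpha> (Suc k)"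
    using assms(1) Suc.prems(2) unfolding discretization_def
    by (metis One_nat_def Suc_leI atLeastAtMost_iff diff_Suc_1 zero_less_Suc)
  then show ?case
    using Suc by (cases "h = k") (auto intro: less_trans)
qed simp

lemma step_function_graded:
  assumes \<alpha>: "discretization p \<alpha>" and f: "step_function p \<alpha> f"
  obtains loc where "grading loc" "graded loc f"
proof -
  \<comment> \<open>This is \<open>2 * h + 1\<close> at \<open>\<alpha> h\<close> and
    \<open>2 * h + 2\<close> strictly between \<open>\<alpha> h\<close> and the next grid point: the
    doubled cell index plus 1. As a count it is monotone on all reals.\<close>
  define loc where "loc t = card {h \<in> {..p}. \<alpha> h < t} + card {h \<in> {..p}. \<alpha> h \<le> t}" for t
  have less: "\<alpha> h < \<alpha> k \<longleftrightarrow> h < k" and le: "\<alpha> h \<le> \<alpha> k \<longleftrightarrow> h \<le> k" if "h \<le> p" "k \<le> p" for h k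
    using that discretization_less[OF \<alpha>, of h k] discretization_less[OF \<alpha>, of k h]
    by (cases h k rule: linorder_cases; force)+
  have side: "\<exists>m. loc t = Suc m \<and> m \<le> 2 * p \<and> t \<in> side \<alpha> m" if t: "0 \<le> t" "t \<le> 1" for t
  proof -
    have \<alpha>01: "\<alpha> 0 = 0" "\<alpha> p = 1"
      using \<alpha> by (auto simp: discretization_def)
    define h where "h = Max {h \<in> {..p}. \<alpha> h \<le> t}"
    have "h \<in> {h \<in> {..p}. \<alpha> h \<le> t}"
      unfolding h_def using t \<alpha>01 by (intro Max_in) (auto intro!: exI[of _ 0])
    then have h: "h \<le> p" "\<alpha> h \<le> t"
      by auto
    have above: "t < \<alpha> k" if "h < k" "k \<le> p" for k
    proof (rule ccontr)
      assume "\<not> t < \<alpha> k"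
      then have "k \<le> h"
        unfolding h_def using that by (intro Max_ge) auto
      then show False using that by simp
    qed
    have le_t: "\<alpha> k \<le> t \<longleftrightarrow> k \<le> h" if "k \<le> p" for k
      using that h above[of k] le[of k h] by (cases "k \<le> h") auto
    then have "{k \<in> {..p}. \<alpha> k \<le> t} = {..h}"
      using h by auto
    then have card_le: "card {k \<in> {..p}. \<alpha> k \<le> t} = Suc h"
      by simp
    show ?thesis
    proof (cases "\<alpha> h = t")
      case True
      then have "{k \<in> {..p}. \<alpha> k < t} = {..<h}"
        using less h by auto
      then have "loc t = Suc (2 * h)"
        unfolding loc_def card_le by simp
      then show ?thesis
        using h True by (intro exI[of _ "2 * h"]) (auto simp: side_def)
    next
      case False
      then have lt: "\<alpha> h < t" using h by simp
      then have "h \<noteq> p" using t \<alpha>01 by auto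
      then have hp: "h < p" using h by simp
      have "\<alpha> k < t \<longleftrightarrow> k \<le> h" if "k \<le> p" for k
        using le_t[OF that] le[OF that h(1)] lt by linarith
      then have "{k \<in> {..p}. \<alpha> k < t} = {..h}"
        using h by auto
      then have "loc t = Suc (2 * h + 1)"
        unfolding loc_def card_le by simp
      then show ?thesis
        using hp lt above[of "Suc h"] by (intro exI[of _ "2 * h + 1"]) (auto simp: side_def)
    qed
  qed
  have "mono loc"
    unfolding loc_def by (intro monoI add_mono card_mono) auto
  moreover have "loc 0 < loc t" if "t \<in> {0<..1}" for t
  proof -
    have "0 \<in> {h \<in> {..p}. \<alpha> h < t} - {h \<in> {..p}. \<alpha> h < 0}"
      using that \<alpha> by (simp add: discretization_def)
    then have "{h \<in> {..p}. \<alpha> h < 0} \<subset> {h \<in> {..p}. \<alpha> h < t}"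
      using that by auto
    then have "card {h \<in> {..p}. \<alpha> h < 0} < card {h \<in> {..p}. \<alpha> h < t}"
      by (intro psubset_card_mono) auto
    moreover have "card {h \<in> {..p}. \<alpha> h \<le> 0} \<le> card {h \<in> {..p}. \<alpha> h \<le> t}"
      using that by (intro card_mono) auto
    ultimately show ?thesis by (simp add: loc_def)
  qed
  moreover have "loc t < loc 1" if "t \<in> {0..<1}" for t
  proof -
    have "p \<in> {h \<in> {..p}. \<alpha> h \<le> 1} - {h \<in> {..p}. \<alpha> h \<le> t}"
      using that \<alpha> by (simp add: discretization_def)
    then have "{h \<in> {..p}. \<alpha> h \<le> t} \<subset> {h \<in> {..p}. \<alpha> h \<le> 1}"
      using that by auto
    then have "card {h \<in> {..p}. \<alpha> h \<le> t} < card {h \<in> {..p}. \<alpha> h \<le> 1}"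
      by (intro psubset_card_mono) auto
    moreover have "card {h \<in> {..p}. \<alpha> h < t} \<le> card {h \<in> {..p}. \<alpha> h < 1}"
      using that by (intro card_mono) auto
    ultimately show ?thesis by (simp add: loc_def)
  qed
  ultimately have "grading loc"
    by (simp add: grading_def)
  moreover have "graded loc f"
    unfolding graded_def
  proof (intro ballI impI)
    fix x y :: "real ^ 'a"
    assume xy: "x \<in> {0..1}" "y \<in> {0..1}" and eq: "\<forall>j. loc (x $ j) = loc (y $ j)"
    \<comment> \<open>Subtracting 1 recovers the doubled cell index shared by \<open>x\<close> and
      \<open>y\<close>.\<close>
    define e where "e j = loc (x $ j) - 1" for j
    have "e j \<le> 2 * p \<and> x $ j \<in> side \<alpha> (e j) \<and> y $ j \<in> side \<alpha> (e j)" for j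
      using side[of "x $ j"] side[of "y $ j"] xy eq by (auto simp: e_def less_eq_vec_def)
    then have "e \<in> cell_indices p" "x \<in> cell \<alpha> e" "y \<in> cell \<alpha> e"
      by (auto simp: cell_indices_def cell_def)
    moreover have "f constant_on cell \<alpha> e"
      using f calculation(1) by (simp add: step_function_def)
    ultimately show "f x = f y"
      by (metis constant_on_def)
  qed
  ultimately show thesis using that by blast
qed

section \<open>Passage to the limit\<close>

lemma approximation_sequence_pointwise:
  assumes v: "interval_simple_game v" and f: "\<And>h. interval_simple_game (f h)"
    and lim: "(\<lambda>h. SUP x\<in>{0..1}. \<bar>v x - f h x\<bar>) \<longlonglongrightarrow> 0" and x: "x \<in> {0..1}"
  shows "(\<lambda>h. f h x) \<longlonglongrightarrow> v x"
proof -
  have "\<bar>f h x - v x\<bar> \<le> (SUP x\<in>{0..1}. \<bar>v x - f h x\<bar>)" for h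
  proof -
    have "bdd_above ((\<lambda>x. \<bar>v x - f h x\<bar>) ` {0..1})"
    proof (rule bdd_aboveI2)
      fix y :: "real ^ 'a" assume y: "y \<in> {0..1}"
      show "\<bar>v y - f h y\<bar> \<le> 1"
        using game_bounds[OF v y] game_bounds[OF f y, of h] by linarith
    qed
    from cSUP_upper[OF x this] show ?thesis
      by (simp add: abs_minus_commute)
  qed
  then have "(\<lambda>h. f h x - v x) \<longlonglongrightarrow> 0"
    by (intro Lim_null_comparison[OF _ lim]) (simp add: always_eventually)
  then show ?thesis
    by (simp add: LIM_zero_iff)
qed

text \<open>Convergence at every point, not just almost everywhere, allows dominated convergence
  with bound 1 after a substitution, that is, on each face.\<close>

lemma face_integrable_limit:
  fixes v :: "real ^ 'n \<Rightarrow> real"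
  assumes games: "\<And>h. interval_simple_game (f h)"
    and int: "\<And>h. face_integrable (f h)"
    and lim: "\<And>x. x \<in> {0..1} \<Longrightarrow> (\<lambda>h. f h x) \<longlonglongrightarrow> v x"
  shows "face_integrable v" "(\<lambda>h. mean_incr (f h) S) \<longlonglongrightarrow> mean_incr v S"
proof -
  have fill: "fill T c x \<in> {0..1}" if "c \<in> {0..1}" "x \<in> {0..1}" for T c and x :: "real ^ 'n"
    using that by (intro fill_in_cube) (auto simp: less_eq_vec_def)
  have one: "(\<lambda>x :: real ^ 'n. 1 :: real) integrable_on {0..1}"
    by (simp add: interval_cbox_cart integrable_const)
  show v: "face_integrable v"
    unfolding face_integrable_def
  proof (intro allI ballI)
    fix T :: "'n set" and c :: real
    assume c: "c \<in> {0..1}"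
    show "(\<lambda>x. v (fill T c x)) integrable_on {0..1}"
    proof (rule dominated_convergence(1)[OF _ one])
      show "(\<lambda>x. f h (fill T c x)) integrable_on {0..1}" for h
        using int c by (auto simp: face_integrable_def)
      show "norm (f h (fill T c x)) \<le> 1" if "x \<in> {0..1}" for h x
        using game_bounds[OF games fill[OF c that]] by simp
      show "(\<lambda>h. f h (fill T c x)) \<longlonglongrightarrow> v (fill T c x)" if "x \<in> {0..1}" for x
        by (intro lim fill c that)
    qed
  qed
  show "(\<lambda>h. mean_incr (f h) S) \<longlonglongrightarrow> mean_incr v S"
    unfolding mean_incr_def
  proof (rule dominated_convergence(2)[OF _ one])
    show "incr (f h) S integrable_on {0..1}" for h
      by (intro face_integrable_incr int)
    fix x :: "real ^ 'n" assume x: "x \<in> {0..1}"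
    have "fill S 0 x \<in> {0..1}" "fill S 1 x \<in> {0..1}"
      using x by (intro fill; simp)+
    then show "norm (incr (f h) S x) \<le> 1" "(\<lambda>h. incr (f h) S x) \<longlonglongrightarrow> incr v S x" for h
      using game_bounds[OF games, of "fill S 0 x" h] game_bounds[OF games, of "fill S 1 x" h]
      by (auto simp: incr_def intro!: tendsto_diff lim)
  qed
qed

theorem theorem2:
  fixes \<Phi> :: "(real ^ 'n::{finite,linorder} \<Rightarrow> real) \<Rightarrow> real ^ 'n::{finite,linorder}"
  assumes "CARD('n) \<ge> 3"
    and "efficient \<Phi>"
    and "null_player_property \<Phi>"
    and "HIS \<Phi>"
    and "discretizable \<Phi>"
  shows "\<forall>v. interval_simple_game v \<and> approximable v \<longrightarrow> \<Phi> v = Psi v"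
proof (intro allI impI, elim conjE)
  fix v :: "real ^ 'n::{finite,linorder} \<Rightarrow> real"
  assume v: "interval_simple_game v" and "approximable v"
  then obtain f where f: "approximation_sequence v f"
    by (auto simp: approximable_def)
  then obtain p \<alpha> where appr: "\<And>h. approximation v (p h) (\<alpha> h) (f h)"
    and sup: "(\<lambda>h. SUP x\<in>{0..1}. \<bar>v x - f h x\<bar>) \<longlonglongrightarrow> 0"
    unfolding approximation_sequence_def by blast
  obtain lam gam :: "'n set \<Rightarrow> real" where share: "\<forall>S \<epsilon> V u v.
      interval_simple_game u \<and> interval_simple_game v \<and> \<epsilon> > 0 \<and> local_increment S \<epsilon> V u v \<longrightarrow>
        (\<forall>i\<in>S. \<Phi> v $ i - \<Phi> u $ i = lam S * \<epsilon> * V) \<and>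
        (\<forall>i\<in>-S. \<Phi> v $ i - \<Phi> u $ i = - gam S * \<epsilon> * V)"
    using assms(4) unfolding HIS_def shares_increments_def by blast
  interpret efficient_sharing \<Phi> lam gam
  proof
    show "CARD('n) \<ge> 2" "CARD('n) \<ge> 3"
      using assms(1) by simp_all
    fix u v :: "real ^ 'n::{finite,linorder} \<Rightarrow> real" and \<epsilon> V S i
    assume "interval_simple_game u" "interval_simple_game v" "0 < \<epsilon>" "local_increment S \<epsilon> V u v"
    then have "interval_simple_game u \<and> interval_simple_game v \<and> \<epsilon> > 0 \<and> local_increment S \<epsilon> V u v"
      by (intro conjI)
    from share[rule_format, OF this]
    show "\<Phi> v $ i - \<Phi> u $ i = (if i \<in> S then lam S else - gam S) * \<epsilon> * V"
      by (cases "i \<in> S") simp_all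
  qed (fact assms)+
  have game: "interval_simple_game (f h)" for h
    using appr by (auto simp: approximation_def)
  have "\<exists>loc. grading loc \<and> graded loc (f h)" for h
  proof -
    have "discretization (p h) (\<alpha> h)" "step_function (p h) (\<alpha> h) (f h)"
      using appr[of h] by (simp_all add: approximation_def regular_step_function_def)
    then show ?thesis
      by (blast elim: step_function_graded)
  qed
  then obtain loc where loc: "\<And>h. grading (loc h)" "\<And>h. graded (loc h) (f h)"
    by metis
  have int: "face_integrable (f h)" for h
    by (rule graded_face_integrable[OF loc(1) game loc(2)])
  have lim: "(\<lambda>h. f h x) \<longlonglongrightarrow> v x" if "x \<in> {0..1}" for x
    by (rule approximation_sequence_pointwise[OF v game sup that])
  have "face_integrable v"
    by (rule face_integrable_limit(1)[of f, OF game int lim])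
  note Psi = Psi_shapley[OF this]
  have mean: "(\<lambda>h. mean_incr (f h) S) \<longlonglongrightarrow> mean_incr v S" for S
    by (rule face_integrable_limit(2)[of f, OF game int lim])
  have "(\<lambda>h. \<Phi> (f h)) \<longlonglongrightarrow> \<Phi> v"
    using assms(5) v f by (auto simp: discretizable_def)
  \<comment> \<open>The indices of the approximations tend to that of \<open>v\<close> by
    discretizability, and to \<open>Psi v\<close> because their Shapley form is continuous in the
    mean increments.\<close>
  have "\<Phi> v $ i = Psi v $ i" for i
  proof (rule LIMSEQ_unique)
    show "(\<lambda>h. \<Phi> (f h) $ i) \<longlonglongrightarrow> \<Phi> v $ i"
      by (intro tendsto_vec_nth) fact
    show "(\<lambda>h. \<Phi> (f h) $ i) \<longlonglongrightarrow> Psi v $ i"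
      unfolding index_graded_shapley[OF loc(1) game loc(2)] Psi
      by (intro tendsto_intros mean)
  qed
  then show "\<Phi> v = Psi v"
    by (simp add: vec_eq_iff)
qed

end
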